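(* Let $\mathbb{X}$ be a Polish space, $\mathfrak{q},\mathfrak{q}_0$ two EPPFs, and assume that $H_0(dx)=a\,\delta_{x_0}(dx)+(1-a)\tilde H(dx)$, where $a\in(0,1)$, $x_0\in\mathbb{X}$ and $\tilde H$ is a diffuse probability measure on $\mathbb{X}$. Let $[\xi_{i,j}]_{i=1,\dots,I,\,j\ge1}$ be a $HSSM(\mathfrak{q},\mathfrak{q}_0,H_0)$, let $n_1(t),\dots,n_I(t)$ be positive integers, $n(t)=\sum_{i=1}^In_i(t)$, and let $\tilde D_{i,t}$ be the number of distinct values in $\{\xi_{i,j}:j=1,\dots,n_i(t)\}$ and $\tilde D_t$ the number of distinct values in $\{\xi_{i,j}:j=1,\dots,n_i(t),\ i=1,\dots,I\}$. Then, for every $i=1,\dots,I$ and $d=1,\dots,n_i(t)$, $$\mathbb{P}\{\tilde D_{i,t}=d\}=(1-a)^d\,\mathbb{P}\{D_{i,t}=d\}+\sum_{k=d}^{n_i(t)}\binom{k}{d-1}a^{k+1-d}(1-a)^{d-1}\,\mathbb{P}\{D_{i,t}=k\},$$ and $\mathbb{P}\{\tilde D_t=d\}$, $d=1,\dots,n(t)$, has the same expression with $D_t$ in place of $D_{i,t}$ and $n(t)$ in place of $n_i(t)$. Moreover, $$\mathbb{E}[\tilde D_{i,t}]=1-\mathbb{E}\big[(1-a)^{D_{i,t}}\big]+(1-a)\,\mathbb{E}[D_{i,t}]\le\mathbb{E}[D_{i,t}],$$ and the analogous relation holds for $\mathbb{E}[\tilde D_t]$ with $D_{i,t}$ replaced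 by $D_t$. Here $D_{i,t}$ and $D_t$ are defined in the context.
   Context: Partitions. $\mathcal{P}_n$ is the set of partitions of $\{1,\dots,n\}$, written $\pi_n=[\pi_{1,n},\dots,\pi_{k,n}]$; $|\pi_n|=k$ is the number of blocks. An exchangeable random partition of $\mathbb{N}$ is a sequence $\Pi=(\Pi_n)_n$ of random partitions of $\{1,\dots,n\}$, consistent under restriction, each with permutation-invariant law; its EPPF is the symmetric function $\mathfrak{q}$ with $\mathbb{P}\{\Pi_n=\pi_n\}=\mathfrak{q}(|\pi_{1,n}|,\dots,|\pi_{k,n}|)=:\mathfrak{q}(\pi_n)$. $p\sim SSrp(\mathfrak{q}_0,H_0)$ means that $p=\sum_{j\ge1}\tilde q_j\delta_{Z_j}$, with $(Z_j)_j$ i.i.d. with law $H_0$, independent of the nonnegative random weights $(\tilde q_j)_j$ with $\sum_j\tilde q_j=1$ a.s., and $\mathfrak{q}_0(n_1,\dots,n_k)=\sum_{j_1,\dots,j_k}\mathbb{E}\big[\prod_{i=1}^k\tilde q_{j_i}^{\,n_i}\big]$, the sum over ordered $k$-tuples of distinct positive integers. An array $[\xi_{i,j}]$ of $\mathbb{X}$-valued random variables is a $HSSM(\mathfrak{q},\mathfrak{q}_0,H_0)$ if for all positive integers $(n_1,\dots,n_I)$ and all Borel sets $A_{i,j}$, $$\mathbb{P}\{\xi_{i,j}\in A_{i,j},\ i=1,\dots,I,\ j=1,\dots,n_i\}=\sum_{\pi^{(1)}_{n_1}\in\mathcal{P}_{n_1},\dots,\pi^{(I)}_{n_I}\in\mathcal{P}_{n_I}}\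 \prod_{i=1}^I\mathfrak{q}\big(\pi^{(i)}_{n_i}\big)\ \mathbb{E}\Big[\prod_{i=1}^I\prod_{c=1}^{|\pi^{(i)}_{n_i}|}\tilde p\Big(\bigcap_{j\in\pi^{(i)}_{c,n_i}}A_{i,j}\Big)\Big],\quad \tilde p\sim SSrp(\mathfrak{q}_0,H_0).$$ Latent cluster numbers. Let $\Pi^{(1)},\dots,\Pi^{(I)}$ be i.i.d. exchangeable random partitions of $\mathbb{N}$ with EPPF $\mathfrak{q}$ and $\Pi^{(0)}$ an independent exchangeable random partition with EPPF $\mathfrak{q}_0$. Then $K_{i,t}:=|\Pi^{(i)}_{n_i(t)}|$, $K_t:=\sum_{i=1}^I|\Pi^{(i)}_{n_i(t)}|$, $D_{i,t}:=|\Pi^{(0)}_{K_{i,t}}|$, $D_t:=|\Pi^{(0)}_{K_t}|$. A measure is diffuse if it gives mass zero to every singleton. *)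

theory Defs
  imports "HOL-Probability.Probability" "HOL-Combinatorics.Permutations"
    "HOL-Library.Multiset" "HOL-Library.Disjoint_Sets"
begin

section \<open>Exchangeable random partitions\<close>

definition partitions :: "nat \<Rightarrow> nat set set set" where
  "partitions n = {\<pi>. partition_on {1..n} \<pi>}"

definition restrict_partition :: "nat \<Rightarrow> nat set set \<Rightarrow> nat set set" where
  "restrict_partition m \<pi> = (\<lambda>B. B \<inter> {1..m}) ` \<pi> - {{}}"

text \<open>
  A symmetric function of finitely many positive integers is encoded as a function on multisets.
  Only the values at nonempty multisets of positive integers are ever used or constrained.
\<close>

type_synonym symmetric_fun = "nat multiset \<Rightarrow> real"

definition at_partition :: "symmetric_fun \<Rightarrow> nat set set \<Rightarrow> real" where
  "at_partition q \<pi> = q (image_mset card (mset_set \<pi>))"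

text \<open>
  The index \<open>n = 0\<close> is harmless: the only partition of the empty set is the empty one.
\<close>

definition exchangeable_random_partition ::
    "'b measure \<Rightarrow> (nat \<Rightarrow> 'b \<Rightarrow> nat set set) \<Rightarrow> bool" where
  "exchangeable_random_partition N R \<longleftrightarrow>
     prob_space N \<and>
     (\<forall>n. R n \<in> measurable N (count_space (partitions n))) \<and>
     (\<forall>n. \<forall>m\<le>n. AE \<omega> in N. R m \<omega> = restrict_partition m (R n \<omega>)) \<and>
     (\<forall>n \<sigma>. \<sigma> permutes {1..n} \<longrightarrow>
        distr N (count_space (partitions n)) (\<lambda>\<omega>. (\<lambda>B. \<sigma> ` B) ` R n \<omega>) =
        distr N (count_space (partitions n)) (R n))"

definition has_EPPF ::
    "'b measure \<Rightarrow> (nat \<Rightarrow> 'b \<Rightarrow> nat set set) \<Rightarrow> symmetric_fun \<Rightarrow> bool" where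
  "has_EPPF N R q \<longleftrightarrow>
     exchangeable_random_partition N R \<and>
     (\<forall>n\<ge>1. \<forall>\<pi>\<in>partitions n.
        measure N {\<omega> \<in> space N. R n \<omega> = \<pi>} = at_partition q \<pi>)"


section \<open>Species sampling random probabilities and HSSM arrays\<close>

text \<open>
  The weights and atoms are enumerated by \<open>nat\<close>, that is, starting from 0 instead of 1.
  Independence of the two sequences is independence of the generated \<open>\<sigma>\<close>-algebras, because
  \<open>indep_var\<close> only covers random variables with values in the same type.
\<close>

definition SSrp ::
    "'c measure \<Rightarrow> ('c \<Rightarrow> 'x::polish_space measure) \<Rightarrow> symmetric_fun \<Rightarrow> 'x measure \<Rightarrow> bool" where
  "SSrp P p q0 H0 \<longleftrightarrow>
     prob_space P \<and>
     (\<exists>(w :: nat \<Rightarrow> 'c \<Rightarrow> real) (Z :: nat \<Rightarrow> 'c \<Rightarrow> 'x).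
        (\<forall>j. w j \<in> borel_measurable P) \<and>
        (\<forall>\<omega>\<in>space P. \<forall>j. 0 \<le> w j \<omega>) \<and>
        (AE \<omega> in P. (\<lambda>j. w j \<omega>) sums 1) \<and>
        prob_space.indep_vars P (\<lambda>_. borel) Z UNIV \<and>
        (\<forall>j. distr P borel (Z j) = H0) \<and>
        prob_space.indep_set P
          (sets (vimage_algebra (space P) (\<lambda>\<omega> j. w j \<omega>) (PiM UNIV (\<lambda>_. borel))))
          (sets (vimage_algebra (space P) (\<lambda>\<omega> j. Z j \<omega>) (PiM UNIV (\<lambda>_. borel)))) \<and>
        (\<forall>ns. ns \<noteq> [] \<and> (\<forall>m\<in>set ns. 0 < m) \<longrightarrow>
           ((\<lambda>js. \<integral>\<omega>. (\<Prod>i<length ns. w (js ! i) \<omega> ^ (ns ! i)) \<partial>P) has_sum q0 (mset ns))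
             {js. length js = length ns \<and> distinct js}) \<and>
        (\<forall>\<omega>\<in>space P. sets (p \<omega>) = sets borel \<and>
           (\<forall>A\<in>sets borel. emeasure (p \<omega>) A =
              (\<Sum>j. ennreal (w j \<omega>) * emeasure (return borel (Z j \<omega>)) A))))"

text \<open>
  The right-hand side below depends on \<open>p\<close> only through the joint law of its weights and atoms,
  so nothing is lost by letting \<open>p\<close> live on a probability space whose points are pairs of a
  sequence of weights and a sequence of atoms.
\<close>

definition HSSM ::
    "'a measure \<Rightarrow> nat \<Rightarrow> (nat \<Rightarrow> nat \<Rightarrow> 'a \<Rightarrow> 'x::polish_space) \<Rightarrow>
     symmetric_fun \<Rightarrow> symmetric_fun \<Rightarrow> 'x measure \<Rightarrow> bool" where
  "HSSM M I \<xi> q q0 H0 \<longleftrightarrow>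
     prob_space M \<and>
     (\<forall>i\<in>{1..I}. \<forall>j\<ge>1. \<xi> i j \<in> measurable M borel) \<and>
     (\<exists>(P :: ((nat \<Rightarrow> real) \<times> (nat \<Rightarrow> 'x)) measure) p. SSrp P p q0 H0 \<and>
        (\<forall>(n :: nat \<Rightarrow> nat) (A :: nat \<Rightarrow> nat \<Rightarrow> 'x set).
           (\<forall>i\<in>{1..I}. 1 \<le> n i) \<and> (\<forall>i\<in>{1..I}. \<forall>j\<in>{1..n i}. A i j \<in> sets borel) \<longrightarrow>
           measure M {\<omega> \<in> space M. \<forall>i\<in>{1..I}. \<forall>j\<in>{1..n i}. \<xi> i j \<omega> \<in> A i j} =
           (\<Sum>\<pi>\<in>(\<Pi>\<^sub>E i\<in>{1..I}. partitions (n i)).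
              (\<Prod>i\<in>{1..I}. at_partition q (\<pi> i)) *
              (\<integral>\<omega>. (\<Prod>i\<in>{1..I}. \<Prod>B\<in>\<pi> i. measure (p \<omega>) (\<Inter>j\<in>B. A i j)) \<partial>P))))"

definition diffuse :: "'x measure \<Rightarrow> bool" where
  "diffuse H \<longleftrightarrow> (\<forall>x\<in>space H. {x} \<in> sets H \<and> emeasure H {x} = 0)"


section \<open>Numbers of distinct values and latent cluster numbers\<close>

definition distinct_row :: "(nat \<Rightarrow> nat \<Rightarrow> 'a \<Rightarrow> 'x) \<Rightarrow> (nat \<Rightarrow> nat) \<Rightarrow> nat \<Rightarrow> 'a \<Rightarrow> nat" where
  "distinct_row \<xi> n i \<omega> = card {\<xi> i j \<omega> | j. j \<in> {1..n i}}"

definition distinct_total :: "(nat \<Rightarrow> nat \<Rightarrow> 'a \<Rightarrow> 'x) \<Rightarrow> nat \<Rightarrow> (nat \<Rightarrow> nat) \<Rightarrow> 'a \<Rightarrow> nat" where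
  "distinct_total \<xi> I n \<omega> = card {\<xi> i j \<omega> | i j. i \<in> {1..I} \<and> j \<in> {1..n i}}"

text \<open>
  In a family \<open>R\<close> of random partitions, \<open>R 0\<close> is the top-level one and
  \<open>R 1, \<dots>, R I\<close> are the row-level ones. The i.i.d. assumption on the latter amounts to mutual
  independence, since the EPPF determines the law of an exchangeable random partition.
\<close>

definition latent_partitions ::
    "'b measure \<Rightarrow> nat \<Rightarrow> (nat \<Rightarrow> nat \<Rightarrow> 'b \<Rightarrow> nat set set) \<Rightarrow>
     symmetric_fun \<Rightarrow> symmetric_fun \<Rightarrow> bool" where
  "latent_partitions N I R q q0 \<longleftrightarrow>
     prob_space N \<and>
     has_EPPF N (R 0) q0 \<and>
     (\<forall>i\<in>{1..I}. has_EPPF N (R i) q) \<and>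
     prob_space.indep_vars N (\<lambda>_. PiM UNIV (\<lambda>n. count_space (partitions n)))
       (\<lambda>i \<omega> n. R i n \<omega>) {0..I}"

definition K_row :: "(nat \<Rightarrow> nat \<Rightarrow> 'b \<Rightarrow> nat set set) \<Rightarrow> (nat \<Rightarrow> nat) \<Rightarrow> nat \<Rightarrow> 'b \<Rightarrow> nat" where
  "K_row R n i \<omega> = card (R i (n i) \<omega>)"

definition K_total :: "(nat \<Rightarrow> nat \<Rightarrow> 'b \<Rightarrow> nat set set) \<Rightarrow> nat \<Rightarrow> (nat \<Rightarrow> nat) \<Rightarrow> 'b \<Rightarrow> nat" where
  "K_total R I n \<omega> = (\<Sum>i=1..I. card (R i (n i) \<omega>))"

definition D_row :: "(nat \<Rightarrow> nat \<Rightarrow> 'b \<Rightarrow> nat set set) \<Rightarrow> (nat \<Rightarrow> nat) \<Rightarrow> nat \<Rightarrow> 'b \<Rightarrow> nat" where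
  "D_row R n i \<omega> = card (R 0 (K_row R n i \<omega>) \<omega>)"

definition D_total :: "(nat \<Rightarrow> nat \<Rightarrow> 'b \<Rightarrow> nat set set) \<Rightarrow> nat \<Rightarrow> (nat \<Rightarrow> nat) \<Rightarrow> 'b \<Rightarrow> nat" where
  "D_total R I n \<omega> = card (R 0 (K_total R I n \<omega>) \<omega>)"

end

theory Submission
  imports Defs
begin

text \<open>
  Given the row partitions, the HSSM formula on rectangles says that the blocks of all rows
  independently pick indices \<open>j\<close> with the random weights \<open>w j\<close>, and that the entries of a block
  equal the atom \<open>Z j\<close> of its index. The kernel of the index map is a partition with EPPF \<open>q0\<close>, so
  the number of indices in use is distributed as the latent cluster number. Since
  weights and atoms are independent, it remains to count the distinct values among \<open>k\<close> i.i.d.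
  draws from \<open>H0\<close>: almost surely only the draws equal to \<open>x0\<close> coincide, so with \<open>m\<close> such draws there are
  \<open>k\<close> distinct values if \<open>m = 0\<close> and \<open>k - m + 1\<close> otherwise, where \<open>m\<close> is binomial.
\<close>

section \<open>Distinct values of i.i.d. draws from a law with one atom\<close>

text \<open>The number of distinct values is not a rectangle event, while the HSSM formula speaks
  only of rectangles. Hence the whole law of the array is identified, as a finite mixture over the
  row partitions with products of \<open>q\<close> as coefficients. The array and the latent
  partitions live on unrelated probability spaces and are never coupled: both counts are reduced to
  the same sum over families of row partitions, in which the top level enters only through
  \<open>block_count_prob q0\<close>. The laws on both sides are computed for a nonempty set
  \<open>S\<close> of rows; \<open>S = {i}\<close> gives the claims on one row and
  \<open>S = {1..I}\<close> those on the whole array. In \<open>distinct_law a k d\<close> the first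
  term is the event that none of \<open>k\<close> draws equals \<open>x0\<close>, which forces
  \<open>k = d\<close>; in the second, \<open>d - 1\<close> draws avoid \<open>x0\<close> and the
  remaining \<open>k + 1 - d\<close>, at least one, share it.\<close>

definition distinct_law :: "real \<Rightarrow> nat \<Rightarrow> nat \<Rightarrow> real" where
  "distinct_law a k d = (if k = d then (1 - a) ^ d else 0) +
     (if d \<le> k then real (k choose (d - 1)) * a ^ (k + 1 - d) * (1 - a) ^ (d - 1) else 0)"

text \<open>Here \<open>t\<close> stands for the set of draws equal to \<open>x0\<close>. A nonempty
  \<open>t\<close> gives \<open>d\<close> values exactly when
  \<open>card t = card J + 1 - d\<close>, and symmetry turns the number of such \<open>t\<close>
  into a binomial coefficient in \<open>d - 1\<close>. The guard \<open>d \<le> k\<close> in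
  \<open>distinct_law\<close> matters at \<open>d = k + 1\<close>: the second term would otherwise
  equal \<open>(1 - a) ^ k\<close>, although \<open>k\<close> draws cannot have \<open>k + 1\<close>
  values.\<close>

lemma sum_subsets_distinct_law:
  assumes "finite J" "1 \<le> d"
  shows "(\<Sum>t\<in>Pow J. if card J - card t + (if t = {} then 0 else 1) = d
            then a ^ card t * (1 - a) ^ (card J - card t) else 0) = distinct_law a (card J) d"
proof -
  let ?k = "card J"
  let ?h = "\<lambda>t. if ?k - card t + (if t = {} then 0 else 1) = d
            then a ^ card t * (1 - a) ^ (?k - card t) else 0"
  let ?T = "{t. t \<subseteq> J \<and> card t = ?k + 1 - d}"
  have fin: "finite (Pow J)" using assms by simp
  have "sum ?h (Pow J) = ?h {} + sum ?h (Pow J - {{}})"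
    using fin by (subst sum.remove[of _ "{}"]) auto
  also have "?h {} = (if ?k = d then (1 - a) ^ d else 0)" by simp
  also have "sum ?h (Pow J - {{}}) =
      (if d \<le> ?k then real (?k choose (d - 1)) * a ^ (?k + 1 - d) * (1 - a) ^ (d - 1) else 0)"
  proof (cases "d \<le> ?k")
    case True
    have "sum ?h (Pow J - {{}}) = (\<Sum>t\<in>?T. a ^ (?k + 1 - d) * (1 - a) ^ (d - 1))"
    proof (rule sum.mono_neutral_cong_right)
      show "?T \<subseteq> Pow J - {{}}" using True by auto
      show "\<forall>t\<in>Pow J - {{}} - ?T. ?h t = 0"
      proof
        fix t assume t: "t \<in> Pow J - {{}} - ?T"
        then have "finite t" using assms(1) by (auto dest: finite_subset)
        then have "1 \<le> card t" "card t \<le> ?k"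
          using t assms(1) card_mono[of J t] by (auto simp: Suc_le_eq card_gt_0_iff)
        moreover have ne: "t \<noteq> {}" "card t \<noteq> ?k + 1 - d" using t by auto
        ultimately have "?k - card t + 1 \<noteq> d" by arith
        then have "?k - card t + (if t = {} then 0 else 1) \<noteq> d" by (subst if_not_P[OF ne(1)])
        then show "?h t = 0" by (rule if_not_P)
      qed
      show "?h t = a ^ (?k + 1 - d) * (1 - a) ^ (d - 1)" if "t \<in> ?T" for t
      proof -
        have "t \<noteq> {}" "?k - card t = d - 1" "?k - card t + 1 = d" "card t = ?k + 1 - d"
          using that True assms(2) by auto
        then show ?thesis by simp
      qed
    qed (use fin in auto)
    also have "\<dots> = real (?k choose (?k + 1 - d)) * (a ^ (?k + 1 - d) * (1 - a) ^ (d - 1))"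
      using n_subsets[OF assms(1), of "?k + 1 - d"] by simp
    also have "?k choose (?k + 1 - d) = ?k choose (d - 1)"
      using True assms(2) binomial_symmetric[of "d - 1" ?k] by simp
    finally show ?thesis using True by (simp add: mult.assoc)
  next
    case False
    have "?h t = 0" if t: "t \<in> Pow J - {{}}" for t
    proof -
      have "finite t" using assms(1) t by (auto dest: finite_subset)
      then have "1 \<le> card t" "card t \<le> ?k" and ne: "t \<noteq> {}"
        using t assms(1) card_mono[of J t] by (auto simp: Suc_le_eq card_gt_0_iff)
      then have "?k - card t + 1 \<noteq> d" using False by arith
      then have "?k - card t + (if t = {} then 0 else 1) \<noteq> d" by (subst if_not_P[OF ne])
      then show ?thesis by (rule if_not_P)
    qed
    then have "sum ?h (Pow J - {{}}) = 0" by (intro sum.neutral) blast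
    then show ?thesis using False by simp
  qed
  finally show ?thesis by (simp add: distinct_law_def)
qed

text \<open>With \<open>e = d - 1\<close> the second term of \<open>distinct_law\<close> is a
  binomial weight, so its part is the binomial mean of \<open>e + 1\<close> without the term
  \<open>e = k\<close>. The missing term is \<open>(k + 1) * (1 - a) ^ k\<close>; the first term of
  \<open>distinct_law\<close> gives back \<open>k * (1 - a) ^ k\<close>, and the difference is the
  probability that the atom is never hit.\<close>

lemma expectation_distinct_law:
  "(\<Sum>d=1..k. real d * distinct_law a k d) = 1 - (1 - a) ^ k + (1 - a) * real k"
proof (cases "k = 0")
  case False
  let ?b = "\<lambda>e. real (k choose e) * a ^ (k - e) * (1 - a) ^ e"
  have binom: "(\<Sum>e\<le>k. ?b e) = 1"
    using binomial_ring[of "1 - a" a k] by (simp add: ac_simps)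
  \<comment> \<open>The mean of a binomial variable, by the absorption identity for binomial
    coefficients.\<close>
  have deg: "(\<Sum>e\<le>k. real e * ?b e) = real k * (1 - a)"
  proof -
    obtain m where m: "k = Suc m" using False by (cases k) auto
    have "(\<Sum>e\<le>k. real e * ?b e) = (\<Sum>e\<le>m. real (Suc e) * ?b (Suc e))"
      by (subst m, subst sum.atMost_Suc_shift) (simp add: m)
    also have "\<dots> = (\<Sum>e\<le>m. real k * (1 - a) * (real (m choose e) * (1 - a) ^ e * a ^ (m - e)))"
    proof (rule sum.cong)
      fix e assume "e \<in> {..m}"
      have "real (Suc e) * real (k choose Suc e) = real k * real (m choose e)"
        unfolding m using Suc_times_binomial[of e m] by (metis of_nat_mult)
      then have "real (Suc e) * ?b (Suc e) = real k * real (m choose e) * a ^ (k - Suc e) * (1 - a) ^ Suc e"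
        by (simp only: mult.assoc[symmetric])
      then show "real (Suc e) * ?b (Suc e) = real k * (1 - a) * (real (m choose e) * (1 - a) ^ e * a ^ (m - e))"
        by (simp add: m)
    qed simp
    also have "\<dots> = real k * (1 - a)"
      using binomial_ring[of "1 - a" a m] by (simp add: sum_distrib_left[symmetric])
    finally show ?thesis .
  qed
  have "(\<Sum>d=1..k. real d * distinct_law a k d) =
      (\<Sum>d=1..k. (if d = k then real k * (1 - a) ^ k else 0) + real d * ?b (d - 1))"
    by (rule sum.cong) (auto simp: distinct_law_def algebra_simps Suc_diff_le)
  also have "\<dots> = real k * (1 - a) ^ k + (\<Sum>d=1..k. real d * ?b (d - 1))"
    using False by (simp add: sum.distrib)
  also have "(\<Sum>d=1..k. real d * ?b (d - 1)) = (\<Sum>e<k. (real e + 1) * ?b e)"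
    by (rule sum.reindex_bij_witness[of _ Suc "\<lambda>d. d - 1"]) auto
  also have "\<dots> = (\<Sum>e\<le>k. (real e + 1) * ?b e) - (real k + 1) * (1 - a) ^ k"
    by (simp add: lessThan_Suc_atMost[symmetric])
  also have "(\<Sum>e\<le>k. (real e + 1) * ?b e) = real k * (1 - a) + 1"
    using binom deg by (simp add: distrib_right sum.distrib)
  finally show ?thesis by (simp add: algebra_simps)
qed (simp add: distinct_law_def)

text \<open>One more variable raises the count exactly when its value is new, and the coincidence of
  two variables is an event in a second countable Hausdorff space.\<close>

lemma measurable_card_image:
  fixes X :: "'i \<Rightarrow> 'a \<Rightarrow> 'x::{second_countable_topology, t2_space}"
  assumes "finite L" "\<And>l. l \<in> L \<Longrightarrow> X l \<in> borel_measurable M"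
  shows "(\<lambda>\<omega>. card ((\<lambda>l. X l \<omega>) ` L)) \<in> measurable M (count_space UNIV)"
  using assms
proof (induction L)
  case (insert l L)
  note insert.prems[measurable]
  have [measurable]: "Measurable.pred M (\<lambda>\<omega>. X j \<omega> = X l \<omega>)" if "j \<in> L" for j
    using measurable_equality_set[of "X j" M "X l"] insert.prems that by (simp add: pred_def)
  have [measurable]: "(\<lambda>\<omega>. card ((\<lambda>l. X l \<omega>) ` L)) \<in> measurable M (count_space UNIV)"
    using insert by simp
  have "(\<lambda>\<omega>. if \<exists>j\<in>L. X j \<omega> = X l \<omega> then card ((\<lambda>l. X l \<omega>) ` L)
      else Suc (card ((\<lambda>l. X l \<omega>) ` L))) \<in> measurable M (count_space UNIV)"
    using insert.hyps by measurable
  also have "(\<lambda>\<omega>. if \<exists>j\<in>L. X j \<omega> = X l \<omega> then card ((\<lambda>l. X l \<omega>) ` L)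
      else Suc (card ((\<lambda>l. X l \<omega>) ` L))) = (\<lambda>\<omega>. card ((\<lambda>l. X l \<omega>) ` insert l L))"
    using insert.hyps by (auto simp: fun_eq_iff card_insert_if image_iff) metis+
  finally show ?case .
qed simp

text \<open>Fubini on the diagonal without \<open>(x0, x0)\<close>: every section is empty or a
  single point other than \<open>x0\<close>, hence null for \<open>H0\<close>.\<close>

lemma (in prob_space) AE_iid_distinct:
  fixes Z :: "'i \<Rightarrow> 'a \<Rightarrow> 'x::polish_space"
  assumes indep: "indep_vars (\<lambda>_. borel) Z J" and J: "i \<in> J" "j \<in> J" "i \<noteq> j"
    and law: "distr M borel (Z i) = H0" "distr M borel (Z j) = H0"
    and null: "\<And>x. x \<noteq> x0 \<Longrightarrow> emeasure H0 {x} = 0"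
  shows "AE \<omega> in M. Z i \<omega> = Z j \<omega> \<longrightarrow> Z j \<omega> = x0"
proof -
  have "indep_var borel ((\<lambda>x. x i) \<circ> (\<lambda>\<omega>. restrict (\<lambda>i. Z i \<omega>) {i}))
      borel ((\<lambda>x. x j) \<circ> (\<lambda>\<omega>. restrict (\<lambda>i. Z i \<omega>) {j}))"
    using J by (intro indep_var_compose[OF indep_var_restrict[OF indep]]) auto
  then have iv: "indep_var borel (Z i) borel (Z j)" by (simp add: comp_def)
  have [measurable]: "Z i \<in> borel_measurable M" "Z j \<in> borel_measurable M"
    using indep J by (auto simp: indep_vars_def)
  have setsH0[measurable_cong]: "sets H0 = sets borel" using law(1) by auto
  interpret H0: prob_space H0 unfolding law(1)[symmetric] by (rule prob_space_distr) simp
  let ?D = "{x \<in> space (borel \<Otimes>\<^sub>M borel). fst x = (snd x::'x)} \<inter> {x. fst x \<noteq> (x0::'x)}"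
  have D[measurable]: "?D \<in> sets (borel \<Otimes>\<^sub>M borel)"
  proof (rule sets.Int)
    show "{x \<in> space (borel \<Otimes>\<^sub>M borel). fst x = (snd x::'x)} \<in> sets (borel \<Otimes>\<^sub>M borel)"
      by (rule measurable_equality_set) auto
    have "{x \<in> space (borel \<Otimes>\<^sub>M (borel::'x measure)). fst x \<noteq> (x0::'x)} \<in> sets (borel \<Otimes>\<^sub>M borel)"
      by measurable
    then show "{x. fst x \<noteq> (x0::'x)} \<in> sets (borel \<Otimes>\<^sub>M (borel::'x measure))"
      by (simp add: space_pair_measure)
  qed
  have "emeasure M {\<omega> \<in> space M. Z i \<omega> = Z j \<omega> \<and> Z i \<omega> \<noteq> x0} =
      emeasure (distr M (borel \<Otimes>\<^sub>M borel) (\<lambda>\<omega>. (Z i \<omega>, Z j \<omega>))) ?D"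
    by (subst emeasure_distr) (auto intro!: arg_cong[where f="emeasure M"] simp: space_pair_measure)
  also have "distr M (borel \<Otimes>\<^sub>M borel) (\<lambda>\<omega>. (Z i \<omega>, Z j \<omega>)) = H0 \<Otimes>\<^sub>M H0"
    using iv law by (simp add: indep_var_distribution_eq)
  also have "emeasure (H0 \<Otimes>\<^sub>M H0) ?D = (\<integral>\<^sup>+x. emeasure H0 (Pair x -` ?D) \<partial>H0)"
    by (rule H0.emeasure_pair_measure_alt) (use D in \<open>simp cong: sets_pair_measure_cong add: setsH0\<close>)
  also have "\<dots> = 0"
  proof -
    have "emeasure H0 (Pair x -` ?D) = 0" for x
    proof -
      have "Pair x -` ?D = (if x = x0 then {} else {x})" by (auto simp: space_pair_measure)
      then show ?thesis using null by simp
    qed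
    then show ?thesis by simp
  qed
  finally show ?thesis
    by (intro AE_I[where N="{\<omega> \<in> space M. Z i \<omega> = Z j \<omega> \<and> Z i \<omega> \<noteq> x0}"]) auto
qed

text \<open>\<open>z\<close> is injective off the fibre of \<open>x0\<close>, and a nonempty fibre
  adds one value.\<close>

lemma card_image_merge:
  assumes "finite J" and inj: "\<And>i j. i \<in> J \<Longrightarrow> j \<in> J \<Longrightarrow> i \<noteq> j \<Longrightarrow> z i = z j \<Longrightarrow> z j = x0"
  shows "card (z ` J) = card J - card {j\<in>J. z j = x0} + (if {j\<in>J. z j = x0} = {} then 0 else 1)"
proof -
  let ?T = "{j\<in>J. z j = x0}"
  have "inj_on z (J - ?T)" using inj by (auto simp: inj_on_def)
  then have 1: "card (z ` (J - ?T)) = card J - card ?T"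
    using assms(1) by (simp add: card_image card_Diff_subset)
  have "z ` J = z ` (J - ?T) \<union> (if ?T = {} then {} else {x0})" by auto
  moreover have "x0 \<notin> z ` (J - ?T)" by auto
  ultimately show ?thesis using 1 assms(1) by auto
qed

text \<open>Almost surely the number of values depends only on the random set \<open>T\<close> of
  draws equal to \<open>x0\<close>. This set takes finitely many values, and each event
  \<open>T = t\<close> is an intersection of independent events of probability \<open>a\<close> or
  \<open>1 - a\<close>.\<close>

lemma (in prob_space) prob_card_iid_atom:
  fixes Z :: "'i \<Rightarrow> 'a \<Rightarrow> 'x::polish_space"
  assumes indep: "indep_vars (\<lambda>_. borel) Z J" and J: "finite J" "J \<noteq> {}" and d: "1 \<le> d"
    and law: "\<And>j. j \<in> J \<Longrightarrow> distr M borel (Z j) = H0"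
    and null: "\<And>x. x \<noteq> x0 \<Longrightarrow> emeasure H0 {x} = 0"
    and atom: "measure H0 {x0} = a"
  shows "prob {\<omega> \<in> space M. card ((\<lambda>j. Z j \<omega>) ` J) = d} = distinct_law a (card J) d"
proof -
  have Z[measurable]: "Z j \<in> borel_measurable M" if "j \<in> J" for j
    using indep that by (auto simp: indep_vars_def)
  define T where "T = (\<lambda>\<omega>. {j\<in>J. Z j \<omega> = x0})"
  let ?g = "\<lambda>t. card J - card t + (if t = {} then 0 else 1)"
  have p1: "prob (Z j -` {x0} \<inter> space M) = a" if "j \<in> J" for j
    using atom law[OF that, symmetric] that by (simp add: measure_distr)
  have p2: "prob (Z j -` (- {x0}) \<inter> space M) = 1 - a" if "j \<in> J" for j
  proof -
    have "Z j -` (- {x0}) \<inter> space M = space M - (Z j -` {x0} \<inter> space M)" by auto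
    moreover have "Z j -` {x0} \<inter> space M \<in> events" using Z[OF that] by measurable
    ultimately show ?thesis using p1[OF that] by (simp add: prob_compl)
  qed
  \<comment> \<open>\<open>J \<noteq> {}\<close> matters here: an empty intersection would be
    \<open>UNIV\<close>, not \<open>space M\<close>.\<close>
  have T: "{\<omega> \<in> space M. T \<omega> = t} = (\<Inter>j\<in>J. Z j -` (if j \<in> t then {x0} else - {x0}) \<inter> space M)"
    if "t \<subseteq> J" for t
    using that J(2) by (auto simp: T_def split: if_splits)
  have T_ev: "{\<omega> \<in> space M. T \<omega> = t} \<in> events" if "t \<subseteq> J" for t
    unfolding T[OF that] using J Z by (intro sets.finite_INT) (auto intro!: measurable_sets[of _ M borel])
  have T_prob: "prob {\<omega> \<in> space M. T \<omega> = t} = a ^ card t * (1 - a) ^ (card J - card t)"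
    if t: "t \<subseteq> J" for t
  proof -
    have "prob {\<omega> \<in> space M. T \<omega> = t} =
        (\<Prod>j\<in>J. prob (Z j -` (if j \<in> t then {x0} else - {x0}) \<inter> space M))"
      unfolding T[OF t] by (rule indep_varsD[OF indep]) (use J in auto)
    also have "\<dots> = (\<Prod>j\<in>J. if j \<in> t then a else 1 - a)"
      by (rule prod.cong) (auto simp: p1 p2)
    also have "\<dots> = a ^ card t * (1 - a) ^ (card J - card t)"
      using t J(1) by (simp add: prod.If_cases Int_absorb1 Diff_eq[symmetric] card_Diff_subset finite_subset)
    finally show ?thesis .
  qed
  have "AE \<omega> in M. \<forall>i\<in>J. \<forall>j\<in>J. i \<noteq> j \<longrightarrow> Z i \<omega> = Z j \<omega> \<longrightarrow> Z j \<omega> = x0"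
    using J(1) AE_iid_distinct[OF indep _ _ _ law law null]
    by (auto simp: AE_finite_all)
  then have AEc: "AE \<omega> in M. card ((\<lambda>j. Z j \<omega>) ` J) = ?g (T \<omega>)"
    unfolding T_def by eventually_elim (rule card_image_merge[OF J(1)], blast)
  let ?E = "{\<omega> \<in> space M. ?g (T \<omega>) = d}"
  have "T \<omega> \<subseteq> J" for \<omega> by (auto simp: T_def)
  then have "{\<omega> \<in> space M. g (T \<omega>) = d} = (\<Union>t\<in>{t\<in>Pow J. g t = d}. {\<omega> \<in> space M. T \<omega> = t})"
    for g :: "'i set \<Rightarrow> nat" by blast
  note E = this[of ?g]
  have "?E \<in> events" unfolding E using J(1) T_ev by (intro sets.finite_UN) auto
  moreover have "{\<omega> \<in> space M. card ((\<lambda>j. Z j \<omega>) ` J) = d} \<in> events"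
  proof -
    have "{\<omega> \<in> space M. card ((\<lambda>j. Z j \<omega>) ` J) = d} =
        (\<lambda>\<omega>. card ((\<lambda>j. Z j \<omega>) ` J)) -` {d} \<inter> space M" by auto
    then show ?thesis
      using measurable_sets[OF measurable_card_image[of J Z M], of "{d}"] J(1) Z by simp
  qed
  moreover have "AE \<omega> in M. \<omega> \<in> {\<omega> \<in> space M. card ((\<lambda>j. Z j \<omega>) ` J) = d} \<longleftrightarrow> \<omega> \<in> ?E"
    using AEc by eventually_elim simp
  ultimately have "prob {\<omega> \<in> space M. card ((\<lambda>j. Z j \<omega>) ` J) = d} = prob ?E"
    by (intro finite_measure_eq_AE)
  also have "\<dots> = (\<Sum>t\<in>{t\<in>Pow J. ?g t = d}. prob {\<omega> \<in> space M. T \<omega> = t})"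
    unfolding E using J(1) T_ev
    by (intro finite_measure_finite_Union) (auto simp: disjoint_family_on_def)
  also have "\<dots> = (\<Sum>t\<in>Pow J. if ?g t = d then a ^ card t * (1 - a) ^ (card J - card t) else 0)"
    using J(1) T_prob by (subst sum.inter_filter[symmetric]) (auto intro!: sum.cong)
  also have "\<dots> = distinct_law a (card J) d"
    by (rule sum_subsets_distinct_law[OF J(1) d])
  finally show ?thesis .
qed

section \<open>Sampling from a species sampling random probability\<close>

text \<open>Dynkin induction on the events instead of uniqueness of measures, because no sign is
  assumed for the coefficients \<open>c\<close>, so that the right-hand side is not a measure at the
  outset. Membership of the whole space in \<open>G\<close> makes the coefficients sum to 1, which
  the complement step uses.\<close>

lemma measure_eq_mixture:
  assumes mu: "prob_space \<mu>" and fin: "finite \<Theta>"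
    and nu: "\<And>t. t \<in> \<Theta> \<Longrightarrow> prob_space (\<nu> t)" "\<And>t. t \<in> \<Theta> \<Longrightarrow> sets (\<nu> t) = sets \<mu>"
    and gen: "sets \<mu> = sigma_sets (space \<mu>) G" "Int_stable G" "G \<subseteq> Pow (space \<mu>)" "space \<mu> \<in> G"
    and eq: "\<And>E. E \<in> G \<Longrightarrow> measure \<mu> E = (\<Sum>t\<in>\<Theta>. c t * measure (\<nu> t) E)"
    and E: "E \<in> sets \<mu>"
  shows "measure \<mu> E = (\<Sum>t\<in>\<Theta>. c t * measure (\<nu> t) E)"
proof -
  interpret mu: prob_space \<mu> by fact
  have total: "(\<Sum>t\<in>\<Theta>. c t) = 1"
  proof -
    have "measure (\<nu> t) (space \<mu>) = 1" if t: "t \<in> \<Theta>" for t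
      using prob_space.prob_space[OF nu(1)[OF t]] sets_eq_imp_space_eq[OF nu(2)[OF t]] by simp
    then show ?thesis using eq[OF gen(4)] mu.prob_space by simp
  qed
  have "E \<in> sigma_sets (space \<mu>) G" using E gen(1) by simp
  with gen(2,3) show ?thesis
  proof (induction rule: sigma_sets_induct_disjoint)
    case (basic A) then show ?case by (rule eq)
  next
    case empty then show ?case by simp
  next
    case (compl A)
    then have A: "A \<in> sets \<mu>" using gen(1) by simp
    have "measure (\<nu> t) (space \<mu> - A) = 1 - measure (\<nu> t) A" if t: "t \<in> \<Theta>" for t
    proof -
      interpret prob_space "\<nu> t" by (rule nu(1)[OF t])
      show ?thesis using prob_compl[of A] A nu(2)[OF t] sets_eq_imp_space_eq[OF nu(2)[OF t]] by simp
    qed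
    then show ?case
      using A compl.IH total by (simp add: mu.prob_compl right_diff_distrib sum_subtractf)
  next
    case (union A)
    then have A: "range A \<subseteq> sets \<mu>" using gen(1) by auto
    have "(\<lambda>i. measure (\<nu> t) (A i)) sums measure (\<nu> t) (\<Union>i. A i)" if t: "t \<in> \<Theta>" for t
    proof -
      interpret prob_space "\<nu> t" by (rule nu(1)[OF t])
      show ?thesis using A nu(2)[OF t] union(1) by (intro finite_measure_UNION) auto
    qed
    then have "(\<lambda>i. \<Sum>t\<in>\<Theta>. c t * measure (\<nu> t) (A i)) sums (\<Sum>t\<in>\<Theta>. c t * measure (\<nu> t) (\<Union>i. A i))"
      by (intro sums_sum sums_mult)
    moreover have "(\<lambda>i. measure \<mu> (A i)) sums measure \<mu> (\<Union>i. A i)"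
      using A union(1) by (intro mu.finite_measure_UNION) auto
    ultimately show ?case using union(3) by (simp add: sums_unique2)
  qed
qed

text \<open>Fubini for a finite product of counting measures, which is again a counting measure,
  namely on the selections \<open>f\<close> of one summand per factor.\<close>

lemma prod_suminf_ennreal:
  fixes g :: "nat \<Rightarrow> nat \<Rightarrow> ennreal"
  assumes "finite S"
  shows "(\<Prod>s\<in>S. \<Sum>j. g s j) = (\<integral>\<^sup>+f. (\<Prod>s\<in>S. g s (f s)) \<partial>count_space (S \<rightarrow>\<^sub>E UNIV))"
proof -
  interpret product_sigma_finite "\<lambda>_::nat. count_space (UNIV::nat set)"
    by (intro product_sigma_finite.intro sigma_finite_measure_count_space_countable) auto
  have "(\<Prod>s\<in>S. \<Sum>j. g s j) = (\<Prod>s\<in>S. integral\<^sup>N (count_space UNIV) (g s))"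
    by (simp add: nn_integral_count_space_nat)
  also have "\<dots> = (\<integral>\<^sup>+f. (\<Prod>s\<in>S. g s (f s)) \<partial>PiM S (\<lambda>_. count_space UNIV))"
    by (rule product_nn_integral_prod[symmetric]) (auto simp: assms)
  also have "PiM S (\<lambda>_::nat. count_space (UNIV::nat set)) = count_space (S \<rightarrow>\<^sub>E UNIV)"
    using assms by (intro count_space_PiM_finite) auto
  finally show ?thesis .
qed

section \<open>Kernels of index maps and numbers of blocks\<close>

definition fibres :: "'i set \<Rightarrow> ('i \<Rightarrow> 'b) \<Rightarrow> 'i set set" where
  "fibres S f = (\<lambda>j. {s\<in>S. f s = j}) ` (f ` S)"

lemma card_fibres: "card (fibres S f) = card (f ` S)"
  unfolding fibres_def by (rule card_image) (auto simp: inj_on_def)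

lemma partition_on_fibres: "partition_on S (fibres S f)"
  by (auto simp: partition_on_def fibres_def disjoint_def)

lemma finite_partitions: "finite (partitions n)"
  unfolding partitions_def by (rule finitely_many_partition_on) simp

text \<open>The law of the number of blocks of a random partition of \<open>{1..m}\<close> with EPPF
  \<open>q0\<close>, written through the EPPF alone. So it serves both for the kernel of an index
  map and for the latent partition.\<close>

definition block_count_prob :: "symmetric_fun \<Rightarrow> nat \<Rightarrow> nat \<Rightarrow> real" where
  "block_count_prob q0 m k = (\<Sum>\<rho>\<in>{\<rho>\<in>partitions m. card \<rho> = k}. at_partition q0 \<rho>)"

lemma card_partition_le:
  assumes "finite A" "partition_on A \<pi>"
  shows "card \<pi> \<le> card A"
proof -
  have fin: "finite B" "B \<noteq> {}" if "B \<in> \<pi>" for B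
    using that partition_onD1[OF assms(2)] partition_onD3[OF assms(2)] assms(1)
    by (auto intro: finite_subset)
  have "card \<pi> = (\<Sum>B\<in>\<pi>. 1)" by simp
  also have "\<dots> \<le> (\<Sum>B\<in>\<pi>. card B)"
    using fin by (intro sum_mono) (simp add: Suc_le_eq card_gt_0_iff)
  also have "\<dots> = card A" using product_partition[OF assms(2)] fin by simp
  finally show ?thesis .
qed

text \<open>Turns the existentially quantified weights and atoms of \<open>SSrp\<close> into
  parameters, so that definitions can refer to them.\<close>

locale species_sampling = prob_space P for P :: "'c measure" +
  fixes w :: "nat \<Rightarrow> 'c \<Rightarrow> real" and Z :: "nat \<Rightarrow> 'c \<Rightarrow> 'x::polish_space"
    and p :: "'c \<Rightarrow> 'x measure" and q0 :: symmetric_fun and H0 :: "'x measure"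
  assumes w_measurable[measurable]: "w j \<in> borel_measurable P"
    and w_nonneg: "\<omega> \<in> space P \<Longrightarrow> 0 \<le> w j \<omega>"
    and w_sums: "AE \<omega> in P. (\<lambda>j. w j \<omega>) sums 1"
    and Z_indep: "indep_vars (\<lambda>_. borel) Z UNIV"
    and Z_law: "distr P borel (Z j) = H0"
    and wZ_indep: "indep_set
          (sets (vimage_algebra (space P) (\<lambda>\<omega> j. w j \<omega>) (PiM UNIV (\<lambda>_. borel))))
          (sets (vimage_algebra (space P) (\<lambda>\<omega> j. Z j \<omega>) (PiM UNIV (\<lambda>_. borel))))"
    and q0_sum: "ns \<noteq> [] \<Longrightarrow> (\<And>m. m \<in> set ns \<Longrightarrow> 0 < m) \<Longrightarrow>
           ((\<lambda>js. \<integral>\<omega>. (\<Prod>i<length ns. w (js ! i) \<omega> ^ (ns ! i)) \<partial>P) has_sum q0 (mset ns))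
             {js. length js = length ns \<and> distinct js}"
    and sets_p: "\<omega> \<in> space P \<Longrightarrow> sets (p \<omega>) = sets borel"
    and emeasure_p: "\<omega> \<in> space P \<Longrightarrow> A \<in> sets borel \<Longrightarrow>
         emeasure (p \<omega>) A = (\<Sum>j. ennreal (w j \<omega>) * emeasure (return borel (Z j \<omega>)) A)"
begin

section \<open>Indices drawn with the random weights\<close>

lemma Z_measurable[measurable]: "Z j \<in> borel_measurable P"
  using Z_indep by (auto simp: indep_vars_def)

text \<open>Makes products of powers of the weights integrable: the EPPF formula uses Bochner
  integrals, the sampling argument nonnegative ones.\<close>

lemma AE_w_le_1: "AE \<omega> in P. \<forall>j. w j \<omega> \<le> 1"
  using w_sums
proof (rule AE_mp, intro AE_I2 impI allI)
  fix \<omega> j assume \<omega>: "\<omega> \<in> space P" "(\<lambda>j. w j \<omega>) sums 1"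
  then have "sum (\<lambda>j. w j \<omega>) {j} \<le> (\<Sum>j. w j \<omega>)"
    using w_nonneg by (intro sum_le_suminf) (auto simp: sums_iff)
  then show "w j \<omega> \<le> 1" using \<omega> by (simp add: sums_iff)
qed

text \<open>The probability that \<open>m\<close> blocks, drawing independently given the weights,
  receive the indices \<open>f 1, ..., f m\<close>, averaged over the weights.\<close>

definition weight :: "nat \<Rightarrow> (nat \<Rightarrow> nat) \<Rightarrow> ennreal" where
  "weight m f = (\<integral>\<^sup>+\<omega>. (\<Prod>s\<in>{1..m}. ennreal (w (f s) \<omega>)) \<partial>P)"

text \<open>Extensional functions make the index maps a countable set. That the density has mass one
  is shown only in \<open>prob_space_labels\<close>.\<close>

definition labels :: "nat \<Rightarrow> (nat \<Rightarrow> nat) measure" where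
  "labels m = density (count_space ({1..m} \<rightarrow>\<^sub>E UNIV)) (weight m)"

lemma space_labels[simp]: "space (labels m) = {1..m} \<rightarrow>\<^sub>E UNIV"
  and sets_labels[simp]: "sets (labels m) = Pow ({1..m} \<rightarrow>\<^sub>E UNIV)"
  by (simp_all add: labels_def)

lemma countable_labels: "countable ({1..m::nat} \<rightarrow>\<^sub>E (UNIV::nat set))"
  by (rule countable_PiE) auto

lemma nn_integral_labels:
  "(\<integral>\<^sup>+f. g f \<partial>labels m) = (\<integral>\<^sup>+f. weight m f * g f \<partial>count_space ({1..m} \<rightarrow>\<^sub>E UNIV))"
  unfolding labels_def by (subst nn_integral_density) auto

text \<open>The first factor is a function of the weights and the second of the atoms, so the
  expectation factorizes. Independence is given for the generated sigma-algebras and has to be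
  passed on to those of the two functionals.\<close>

lemma nn_integral_weights_atoms:
  assumes A: "\<And>s. s \<in> {1..m} \<Longrightarrow> A s \<in> sets borel"
  shows "(\<integral>\<^sup>+\<omega>. (\<Prod>s\<in>{1..m}. ennreal (w (f s) \<omega>)) * indicator {\<omega>. \<forall>s\<in>{1..m}. Z (f s) \<omega> \<in> A s} \<omega> \<partial>P) =
     weight m f * emeasure P {\<omega> \<in> space P. \<forall>s\<in>{1..m}. Z (f s) \<omega> \<in> A s}"
proof -
  let ?W = "vimage_algebra (space P) (\<lambda>\<omega> j. w j \<omega>) (PiM UNIV (\<lambda>_. borel))"
  let ?Z = "vimage_algebra (space P) (\<lambda>\<omega> j. Z j \<omega>) (PiM UNIV (\<lambda>_. borel))"
  define X where "X \<omega> = (\<Prod>s\<in>{1..m}. ennreal (w (f s) \<omega>))" for \<omega>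
  define Y where "Y \<omega> = (indicator {\<omega>. \<forall>s\<in>{1..m}. Z (f s) \<omega> \<in> A s} \<omega> :: ennreal)" for \<omega>
  have Xm: "X \<in> borel_measurable ?W"
  proof -
    have "(\<lambda>x::nat \<Rightarrow> real. \<Prod>s\<in>{1..m}. ennreal (x (f s))) \<in> borel_measurable (PiM UNIV (\<lambda>_. borel))"
      by measurable
    from measurable_compose[OF measurable_vimage_algebra1 this, of "\<lambda>\<omega> j. w j \<omega>" "space P"]
    show ?thesis by (simp add: X_def[abs_def] space_PiM)
  qed
  have Ym: "Y \<in> borel_measurable ?Z"
  proof -
    have "(\<lambda>x::nat \<Rightarrow> 'x. indicator {x\<in>space (PiM UNIV (\<lambda>_. borel)). \<forall>s\<in>{1..m}. x (f s) \<in> A s} x :: ennreal)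
        \<in> borel_measurable (PiM UNIV (\<lambda>_. borel))"
      using A by measurable
    from measurable_compose[OF measurable_vimage_algebra1 this, of "\<lambda>\<omega> j. Z j \<omega>" "space P"]
    show ?thesis by (simp add: Y_def[abs_def] space_PiM indicator_def)
  qed
  have E: "{\<omega>\<in>space P. \<forall>s\<in>{1..m}. Z (f s) \<omega> \<in> A s} \<in> sets P"
  proof -
    have [measurable]: "A s \<in> sets borel" if "s \<in> {1..m}" for s using A that .
    show ?thesis by measurable
  qed
  have "indep_var borel X borel Y"
  proof -
    have 1: "random_variable borel X" unfolding X_def by measurable
    from E have 2: "random_variable borel Y"
      unfolding Y_def by (subst measurable_cong[of P _ "indicator {\<omega>\<in>space P. \<forall>s\<in>{1..m}. Z (f s) \<omega> \<in> A s}"])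
        (auto simp: indicator_def)
    \<comment> \<open>A variable measurable for \<open>Q\<close> generates a sub-sigma-algebra of
      \<open>Q\<close>. This is applied with \<open>Q\<close> generated by the weights, with
      \<open>Q\<close> generated by the atoms, and with \<open>P\<close> itself.\<close>
    have sub: "sigma_sets (space P) {U -` B \<inter> space P |B. B \<in> sets borel} \<subseteq> sets Q"
      if "U \<in> borel_measurable Q" "space Q = space P" for U :: "'c \<Rightarrow> ennreal" and Q
      using that by (intro sets.sigma_sets_subset[of _ Q, unfolded that(2)]) (use that measurable_sets[of U Q borel] in auto)
    have "indep_set (sigma_sets (space P) {X -` B \<inter> space P |B. B \<in> sets borel})
          (sigma_sets (space P) {Y -` B \<inter> space P |B. B \<in> sets borel})"
    proof (rule indep_setI)
      show "prob (a \<inter> b) = prob a * prob b"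
        if "a \<in> sigma_sets (space P) {X -` B \<inter> space P |B. B \<in> sets borel}"
          "b \<in> sigma_sets (space P) {Y -` B \<inter> space P |B. B \<in> sets borel}" for a b
        using indep_setD[OF wZ_indep subsetD[OF sub[OF Xm]] subsetD[OF sub[OF Ym]]] that by simp
    qed (use sub[OF 1] sub[OF 2] in simp_all)
    with 1 2 show ?thesis by (simp add: indep_var_eq)
  qed
  then have "indep_vars (\<lambda>_. borel) (case_bool X Y) UNIV"
    unfolding indep_var_def by (rule indep_vars_cong[THEN iffD1, rotated 3]) (auto split: bool.split)
  from indep_vars_nn_integral[OF _ this]
  have "(\<integral>\<^sup>+\<omega>. X \<omega> * Y \<omega> \<partial>P) = (\<integral>\<^sup>+\<omega>. X \<omega> \<partial>P) * (\<integral>\<^sup>+\<omega>. Y \<omega> \<partial>P)"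
    by (simp add: UNIV_bool mult.commute)
  also have "(\<integral>\<^sup>+\<omega>. Y \<omega> \<partial>P) = (\<integral>\<^sup>+\<omega>. indicator {\<omega>\<in>space P. \<forall>s\<in>{1..m}. Z (f s) \<omega> \<in> A s} \<omega> \<partial>P)"
    by (intro nn_integral_cong) (auto simp: Y_def indicator_def)
  also have "\<dots> = emeasure P {\<omega>\<in>space P. \<forall>s\<in>{1..m}. Z (f s) \<omega> \<in> A s}"
    using E by (rule nn_integral_indicator)
  finally show ?thesis by (simp add: X_def Y_def weight_def)
qed

text \<open>Multiplying out gives one term for each choice \<open>f\<close> of an index per factor,
  and weights and atoms separate term by term. The left-hand side is the mean of the product of the
  masses that \<open>p\<close> gives to the sets \<open>A s\<close>.\<close>

lemma nn_integral_prod_sampling: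
  assumes A: "\<And>s. s \<in> {1..m} \<Longrightarrow> A s \<in> sets borel"
  shows "(\<integral>\<^sup>+\<omega>. (\<Prod>s\<in>{1..m}. \<Sum>j. ennreal (w j \<omega>) * indicator (A s) (Z j \<omega>)) \<partial>P) =
    (\<integral>\<^sup>+f. emeasure P {\<omega> \<in> space P. \<forall>s\<in>{1..m}. Z (f s) \<omega> \<in> A s} \<partial>labels m)"
proof -
  let ?F = "{1..m} \<rightarrow>\<^sub>E (UNIV::nat set)"
  have "(\<integral>\<^sup>+\<omega>. (\<Prod>s\<in>{1..m}. \<Sum>j. ennreal (w j \<omega>) * indicator (A s) (Z j \<omega>)) \<partial>P) =
    (\<integral>\<^sup>+\<omega>. (\<integral>\<^sup>+f. (\<Prod>s\<in>{1..m}. ennreal (w (f s) \<omega>) * indicator (A s) (Z (f s) \<omega>)) \<partial>count_space ?F) \<partial>P)"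
    by (simp add: prod_suminf_ennreal)
  also have "\<dots> = (\<integral>\<^sup>+f. (\<integral>\<^sup>+\<omega>. (\<Prod>s\<in>{1..m}. ennreal (w (f s) \<omega>) * indicator (A s) (Z (f s) \<omega>)) \<partial>P) \<partial>count_space ?F)"
  proof (rule nn_integral_count_space_nn_integral[OF countable_labels])
    fix f :: "nat \<Rightarrow> nat"
    have [measurable]: "A s \<in> sets borel" if "s \<in> {1..m}" for s using A that .
    show "(\<lambda>\<omega>. \<Prod>s\<in>{1..m}. ennreal (w (f s) \<omega>) * indicator (A s) (Z (f s) \<omega>)) \<in> borel_measurable P"
      by measurable
  qed
  also have "\<dots> = (\<integral>\<^sup>+f. weight m f * emeasure P {\<omega> \<in> space P. \<forall>s\<in>{1..m}. Z (f s) \<omega> \<in> A s} \<partial>count_space ?F)"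
  proof (rule nn_integral_cong)
    fix f :: "nat \<Rightarrow> nat"
    have "(\<Prod>s\<in>{1..m}. indicator (A s) (Z (f s) \<omega>) :: ennreal) = indicator {\<omega>. \<forall>s\<in>{1..m}. Z (f s) \<omega> \<in> A s} \<omega>" for \<omega>
      by (auto simp: indicator_def)
    then show "(\<integral>\<^sup>+\<omega>. (\<Prod>s\<in>{1..m}. ennreal (w (f s) \<omega>) * indicator (A s) (Z (f s) \<omega>)) \<partial>P) =
        weight m f * emeasure P {\<omega> \<in> space P. \<forall>s\<in>{1..m}. Z (f s) \<omega> \<in> A s}"
      using nn_integral_weights_atoms[where m=m and f=f and A=A, OF A] by (simp add: prod.distrib)
  qed
  finally show ?thesis by (simp add: nn_integral_labels)
qed

lemma AE_suminf_w: "AE \<omega> in P. (\<Sum>j. ennreal (w j \<omega>)) = 1"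
  using w_sums
proof (rule AE_mp, intro AE_I2 impI)
  fix \<omega> assume "\<omega> \<in> space P" "(\<lambda>j. w j \<omega>) sums 1"
  then show "(\<Sum>j. ennreal (w j \<omega>)) = 1"
    using w_nonneg by (subst suminf_ennreal2) (auto simp: sums_iff)
qed

lemma prob_space_labels: "prob_space (labels m)"
proof
  have "emeasure (labels m) (space (labels m)) = (\<integral>\<^sup>+f. 1 \<partial>labels m)" by simp
  \<comment> \<open>With \<open>A s = UNIV\<close> the atoms impose no condition, and only the total
    weight remains.\<close>
  also have "\<dots> = (\<integral>\<^sup>+\<omega>. (\<Prod>s\<in>{1..m}. \<Sum>j. ennreal (w j \<omega>)) \<partial>P)"
    using nn_integral_prod_sampling[of m "\<lambda>_. UNIV"] by (simp add: emeasure_space_1)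
  also have "\<dots> = (\<integral>\<^sup>+\<omega>. 1 \<partial>P)"
    using AE_suminf_w by (intro nn_integral_cong_AE) (auto elim!: eventually_mono)
  finally show "emeasure (labels m) (space (labels m)) = 1" by (simp add: emeasure_space_1)
qed

section \<open>Arrays of atoms with random indices\<close>

lemma measurable_labels:
  "(\<lambda>(f, \<omega>). Z (f s) \<omega>) \<in> borel_measurable (labels m \<Otimes>\<^sub>M P)"
proof -
  have "(\<lambda>(f, \<omega>). Z (f s) \<omega>) \<in> borel_measurable (count_space ({1..m} \<rightarrow>\<^sub>E UNIV) \<Otimes>\<^sub>M P)"
    by (rule measurable_pair_measure_countable1[OF countable_labels]) simp
  then show ?thesis
    by (subst measurable_cong_sets[OF sets_pair_measure_cong[OF _ refl] refl,
          of _ "count_space ({1..m} \<rightarrow>\<^sub>E UNIV)"]) auto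
qed

text \<open>
  Here \<open>\<tau> l\<close> is the number of the block that contains \<open>l\<close>. The labels of the blocks and the atoms
  may be taken independent because the weights are independent of the atoms.
\<close>

definition array_law :: "nat \<Rightarrow> ('l \<Rightarrow> nat) \<Rightarrow> 'l set \<Rightarrow> ('l \<Rightarrow> 'x) measure" where
  "array_law m \<tau> L = distr (labels m \<Otimes>\<^sub>M P) (PiM L (\<lambda>_. borel)) (\<lambda>(f, \<omega>). \<lambda>l\<in>L. Z (f (\<tau> l)) \<omega>)"

lemma measurable_array:
  "(\<lambda>(f, \<omega>). \<lambda>l\<in>L. Z (f (\<tau> l)) \<omega>) \<in> measurable (labels m \<Otimes>\<^sub>M P) (PiM L (\<lambda>_. borel))"
  using measurable_labels unfolding split_def by (intro measurable_restrict) auto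

lemma prob_space_array_law: "prob_space (array_law m \<tau> L)"
proof -
  interpret V: prob_space "labels m" by (rule prob_space_labels)
  interpret VP: pair_prob_space "labels m" P ..
  show ?thesis unfolding array_law_def by (rule VP.prob_space_distr) (rule measurable_array)
qed

lemma sets_array_law[simp]: "sets (array_law m \<tau> L) = sets (PiM L (\<lambda>_. borel))"
  by (simp add: array_law_def)

lemma emeasure_array_law:
  assumes "E \<in> sets (PiM L (\<lambda>_. borel))"
  shows "emeasure (array_law m \<tau> L) E =
    (\<integral>\<^sup>+f. emeasure P {\<omega> \<in> space P. (\<lambda>l\<in>L. Z (f (\<tau> l)) \<omega>) \<in> E} \<partial>labels m)"
proof -
  have "emeasure (array_law m \<tau> L) E =
      emeasure (labels m \<Otimes>\<^sub>M P) ((\<lambda>(f, \<omega>). \<lambda>l\<in>L. Z (f (\<tau> l)) \<omega>) -` E \<inter> space (labels m \<Otimes>\<^sub>M P))"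
    unfolding array_law_def using assms measurable_array by (intro emeasure_distr) auto
  also have "\<dots> = (\<integral>\<^sup>+f. emeasure P (Pair f -` ((\<lambda>(f, \<omega>). \<lambda>l\<in>L. Z (f (\<tau> l)) \<omega>) -` E \<inter> space (labels m \<Otimes>\<^sub>M P))) \<partial>labels m)"
    using measurable_sets[OF measurable_array assms] by (rule emeasure_pair_measure_alt)
  also have "\<dots> = (\<integral>\<^sup>+f. emeasure P {\<omega> \<in> space P. (\<lambda>l\<in>L. Z (f (\<tau> l)) \<omega>) \<in> E} \<partial>labels m)"
    by (intro nn_integral_cong arg_cong[where f="emeasure P"]) (auto simp: space_pair_measure)
  finally show ?thesis .
qed

lemma emeasure_p_eq:
  assumes "\<omega> \<in> space P" "C \<in> sets borel"
  shows "emeasure (p \<omega>) C = (\<Sum>j. ennreal (w j \<omega>) * indicator C (Z j \<omega>))"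
  using emeasure_p[OF assms] assms by simp

lemma measurable_p:
  assumes C[measurable]: "C \<in> sets borel"
  shows "(\<lambda>\<omega>. measure (p \<omega>) C) \<in> borel_measurable P"
proof -
  have "(\<lambda>\<omega>. enn2real (\<Sum>j. ennreal (w j \<omega>) * indicator C (Z j \<omega>))) \<in> borel_measurable P"
    by measurable
  then show ?thesis
    by (subst measurable_cong[of P _ "\<lambda>\<omega>. enn2real (\<Sum>j. ennreal (w j \<omega>) * indicator C (Z j \<omega>))"])
      (auto simp: measure_def emeasure_p_eq[OF _ C])
qed

text \<open>The weights sum to 1 only almost surely, so \<open>measure (p \<omega>)\<close> is
  rewritten under \<open>AE\<close> below.\<close>

lemma AE_prob_space_p: "AE \<omega> in P. prob_space (p \<omega>)"
  using AE_suminf_w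
proof (rule AE_mp, intro AE_I2 impI)
  fix \<omega> assume \<omega>: "\<omega> \<in> space P" "(\<Sum>j. ennreal (w j \<omega>)) = 1"
  then have "emeasure (p \<omega>) (space (p \<omega>)) = 1"
    using emeasure_p_eq[OF \<omega>(1), of UNIV] sets_eq_imp_space_eq[OF sets_p[OF \<omega>(1)]] by simp
  then show "prob_space (p \<omega>)" by (rule prob_spaceI)
qed

text \<open>The integrand is that of the HSSM formula with the blocks of all rows numbered by
  \<open>s\<close>. That \<open>Z (f s) \<omega>\<close> lies in every \<open>A l\<close> with
  \<open>l\<close> in block \<open>s\<close>, for all \<open>s\<close>, says that the array with
  entries \<open>Z (f (\<tau> l)) \<omega>\<close> lies in the rectangle.\<close>

lemma integral_prod_random_measure:
  fixes \<tau> :: "'l \<Rightarrow> nat"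
  assumes L: "finite L" "\<tau> ` L \<subseteq> {1..m}"
    and A: "\<And>l. l \<in> L \<Longrightarrow> A l \<in> sets borel"
  shows "(\<integral>\<omega>. (\<Prod>s\<in>{1..m}. measure (p \<omega>) (\<Inter>l\<in>{l\<in>L. \<tau> l = s}. A l)) \<partial>P) =
    measure (array_law m \<tau> L) (Pi\<^sub>E L A)"
proof -
  let ?B = "\<lambda>s. \<Inter>l\<in>{l\<in>L. \<tau> l = s}. A l"
  have B: "?B s \<in> sets borel" for s
  proof (cases "{l\<in>L. \<tau> l = s} = {}")
    \<comment> \<open>A number \<open>s\<close> that \<open>\<tau>\<close> does not attain gives the
      empty intersection \<open>UNIV\<close>.\<close>
    case True then show ?thesis by (simp only: INT_empty) simp
  next
    case False then show ?thesis using L(1) A by (intro sets.finite_INT) auto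
  qed
  have "(\<integral>\<omega>. (\<Prod>s\<in>{1..m}. measure (p \<omega>) (?B s)) \<partial>P) =
      enn2real (\<integral>\<^sup>+\<omega>. ennreal (\<Prod>s\<in>{1..m}. measure (p \<omega>) (?B s)) \<partial>P)"
    using measurable_p[OF B] by (intro integral_eq_nn_integral) (auto intro!: prod_nonneg)
  also have "(\<integral>\<^sup>+\<omega>. ennreal (\<Prod>s\<in>{1..m}. measure (p \<omega>) (?B s)) \<partial>P) =
      (\<integral>\<^sup>+\<omega>. (\<Prod>s\<in>{1..m}. \<Sum>j. ennreal (w j \<omega>) * indicator (?B s) (Z j \<omega>)) \<partial>P)"
  proof (rule nn_integral_cong_AE, use AE_prob_space_p in \<open>rule AE_mp\<close>, intro AE_I2 impI)
    fix \<omega> assume \<omega>: "\<omega> \<in> space P" "prob_space (p \<omega>)"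
    interpret p: prob_space "p \<omega>" by fact
    show "ennreal (\<Prod>s\<in>{1..m}. measure (p \<omega>) (?B s)) =
       (\<Prod>s\<in>{1..m}. \<Sum>j. ennreal (w j \<omega>) * indicator (?B s) (Z j \<omega>))"
      by (subst prod_ennreal[symmetric])
        (auto simp: p.emeasure_eq_measure[symmetric] emeasure_p_eq[OF \<omega>(1) B])
  qed
  also have "\<dots> = (\<integral>\<^sup>+f. emeasure P {\<omega> \<in> space P. \<forall>s\<in>{1..m}. Z (f s) \<omega> \<in> ?B s} \<partial>labels m)"
    by (rule nn_integral_prod_sampling) (rule B)
  also have "\<dots> = (\<integral>\<^sup>+f. emeasure P {\<omega> \<in> space P. (\<lambda>l\<in>L. Z (f (\<tau> l)) \<omega>) \<in> Pi\<^sub>E L A} \<partial>labels m)"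
    using L(2) by (intro nn_integral_cong arg_cong[where f="emeasure P"]) (auto simp: PiE_iff image_subset_iff)
  also have "\<dots> = emeasure (array_law m \<tau> L) (Pi\<^sub>E L A)"
    using L(1) A by (intro emeasure_array_law[symmetric] sets_PiM_I_finite) auto
  finally show ?thesis by (simp add: measure_def)
qed

text \<open>An index map with kernel \<open>\<rho>\<close> amounts to a tuple of distinct indices,
  one for each block in a fixed enumeration \<open>Bs\<close>, and the sum over these tuples is the
  series that defines \<open>q0\<close>. For \<open>m = 0\<close> the list of block sizes would be
  empty, where \<open>q0_sum\<close> says nothing.\<close>

lemma prob_labels_kernel:
  assumes \<rho>: "partition_on {1..m} \<rho>" and m: "1 \<le> m"
  shows "measure (labels m) {f \<in> {1..m} \<rightarrow>\<^sub>E UNIV. fibres {1..m} f = \<rho>} = at_partition q0 \<rho>"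
proof -
  have fin\<rho>: "finite \<rho>" using finite_elements[OF _ \<rho>] by simp
  obtain Bs where Bs: "set Bs = \<rho>" "distinct Bs" using finite_distinct_list[OF fin\<rho>] by blast
  define k where "k = length Bs"
  define ns where "ns = map card Bs"
  have B: "Bs ! i \<subseteq> {1..m}" "Bs ! i \<noteq> {}" "finite (Bs ! i)" if "i < k" for i
  proof -
    have "Bs ! i \<in> \<rho>" using that Bs by (auto simp: k_def)
    then show "Bs ! i \<subseteq> {1..m}" "Bs ! i \<noteq> {}"
      using partition_onD1[OF \<rho>] partition_onD3[OF \<rho>] by auto
    then show "finite (Bs ! i)" by (auto dest: finite_subset)
  qed
  have B_disj: "i = j" if "s \<in> Bs ! i" "s \<in> Bs ! j" "i < k" "j < k" for s i j
  proof (rule ccontr)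
    assume "i \<noteq> j"
    then have "Bs ! i \<noteq> Bs ! j" using that Bs(2) by (simp add: k_def nth_eq_iff_index_eq)
    moreover have "Bs ! i \<in> \<rho>" "Bs ! j \<in> \<rho>" using that Bs(1) by (auto simp: k_def)
    ultimately have "Bs ! i \<inter> Bs ! j = {}" using partition_onD2[OF \<rho>] by (auto dest: disjointD)
    then show False using that by auto
  qed
  have "\<exists>i. i < k \<and> s \<in> Bs ! i" if s: "s \<in> {1..m}" for s
  proof -
    obtain b where "b \<in> \<rho>" "s \<in> b" using s partition_onD1[OF \<rho>] by blast
    then show ?thesis using Bs by (auto simp: in_set_conv_nth k_def)
  qed
  then obtain idx where idx: "idx s < k" "s \<in> Bs ! idx s" if "s \<in> {1..m}" for s by metis
  have idx_eq: "idx s = i" if "s \<in> Bs ! i" "i < k" for s i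
    using B_disj[of s "idx s" i] idx[of s] B(1)[of i] that by auto
  have rep: "\<exists>s. s \<in> Bs ! i" if "i < k" for i using B(2)[OF that] by auto
  then obtain r where r: "r i \<in> Bs ! i" if "i < k" for i by metis
  have r': "r i \<in> {1..m}" "idx (r i) = i" if "i < k" for i
    using r[OF that] B(1)[OF that] idx_eq that by auto
  have Bs_idx: "Bs ! i = {s\<in>{1..m}. idx s = i}" if "i < k" for i
    using idx_eq B(1)[OF that] idx(2) that by auto
  \<comment> \<open>\<open>\<phi>\<close> spreads a list of indices over the blocks; its inverse
    reads a map off at the representatives \<open>r i\<close>.\<close>
  define \<phi> where "\<phi> js = (\<lambda>s\<in>{1..m}. js ! idx s :: nat)" for js
  let ?J = "{js::nat list. length js = k \<and> distinct js}"
  let ?K = "{f \<in> {1..m} \<rightarrow>\<^sub>E (UNIV::nat set). fibres {1..m} f = \<rho>}"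
  \<comment> \<open>Both directions are used: equal values within a block let the representatives
    determine \<open>f\<close>, and different values across blocks make the list distinct.\<close>
  have same: "f s = f t \<longleftrightarrow> idx s = idx t" if f: "f \<in> ?K" and st: "s \<in> {1..m}" "t \<in> {1..m}" for f s t
  proof -
    have "{u\<in>{1..m}. f u = f s} \<in> fibres {1..m} f"
      unfolding fibres_def by (intro imageI st)
    then have "{u\<in>{1..m}. f u = f s} \<in> \<rho>" using f by simp
    then obtain i where i: "i < k" "{u\<in>{1..m}. f u = f s} = Bs ! i"
      using Bs by (auto simp: in_set_conv_nth k_def)
    then have "idx s = i" using idx_eq[of s i] st by blast
    have "f t = f s \<longleftrightarrow> t \<in> {u\<in>{1..m}. f u = f s}" using st by blast
    also have "\<dots> \<longleftrightarrow> idx t = i" unfolding i(2) Bs_idx[OF i(1)] using st by blast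
    finally show ?thesis unfolding \<open>idx s = i\<close> by metis
  qed
  have bij: "bij_betw \<phi> ?J ?K"
  proof (rule bij_betw_byWitness[where f'="\<lambda>f. map (\<lambda>i. f (r i)) [0..<k]"])
    show "\<forall>js\<in>?J. map (\<lambda>i. \<phi> js (r i)) [0..<k] = js"
      using r' by (auto intro!: nth_equalityI simp: \<phi>_def)
    show "\<forall>f\<in>?K. \<phi> (map (\<lambda>i. f (r i)) [0..<k]) = f"
    proof
      fix f assume f: "f \<in> ?K"
      show "\<phi> (map (\<lambda>i. f (r i)) [0..<k]) = f"
      proof
        fix s
        show "\<phi> (map (\<lambda>i. f (r i)) [0..<k]) s = f s"
        proof (cases "s \<in> {1..m}")
          case True
          then show ?thesis using same[OF f r'(1)[OF idx(1)[OF True]] True] r'(2) idx(1)[OF True]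
            by (simp add: \<phi>_def)
        next
          case False
          then show ?thesis using f by (auto simp: \<phi>_def PiE_def extensional_def)
        qed
      qed
    qed
    show "\<phi> ` ?J \<subseteq> ?K"
    proof (rule image_subsetI)
      fix js :: "nat list" assume "js \<in> ?J"
      then have js: "k = length js" "distinct js" by auto
      have fib: "{u\<in>{1..m}. \<phi> js u = \<phi> js s} = Bs ! idx s" if "s \<in> {1..m}" for s
        using that js idx(1) by (auto simp: \<phi>_def Bs_idx nth_eq_iff_index_eq)
      have "fibres {1..m} (\<phi> js) = (\<lambda>s. Bs ! idx s) ` {1..m}"
        unfolding fibres_def image_image using fib by (intro image_cong) auto
      also have "\<dots> = (\<lambda>i. Bs ! i) ` (idx ` {1..m})" by (simp add: image_image)
      also have "idx ` {1..m} = {..<k}"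
      proof
        show "idx ` {1..m} \<subseteq> {..<k}" using idx(1) by blast
        show "{..<k} \<subseteq> idx ` {1..m}"
        proof
          fix i assume "i \<in> {..<k}"
          then show "i \<in> idx ` {1..m}" using r'[of i] by (intro image_eqI[of _ _ "r i"]) auto
        qed
      qed
      also have "(\<lambda>i. Bs ! i) ` {..<k} = \<rho>" using Bs(1) by (auto simp: k_def set_conv_nth)
      finally have "fibres {1..m} (\<phi> js) = \<rho>" .
      moreover have "\<phi> js \<in> {1..m} \<rightarrow>\<^sub>E UNIV" by (auto simp: \<phi>_def)
      ultimately show "\<phi> js \<in> ?K" by simp
    qed
    show "(\<lambda>f. map (\<lambda>i. f (r i)) [0..<k]) ` ?K \<subseteq> ?J"
      using same r' by (auto simp: distinct_conv_nth)
  qed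
  have weight_\<phi>: "weight m (\<phi> js) = ennreal (\<integral>\<omega>. (\<Prod>i<length ns. w (js ! i) \<omega> ^ (ns ! i)) \<partial>P)"
    if js: "js \<in> ?J" for js
  proof -
    have "(\<Prod>s\<in>{1..m}. ennreal (w (\<phi> js s) \<omega>)) = ennreal (\<Prod>i<length ns. w (js ! i) \<omega> ^ (ns ! i))"
      if \<omega>: "\<omega> \<in> space P" for \<omega>
    proof -
      have "(\<Prod>s\<in>{1..m}. ennreal (w (\<phi> js s) \<omega>)) = ennreal (\<Prod>s\<in>{1..m}. w (js ! idx s) \<omega>)"
        using w_nonneg[OF \<omega>] by (subst prod_ennreal[symmetric]) (auto simp: \<phi>_def)
      \<comment> \<open>Grouping the factors by block gives powers with the block sizes as
        exponents.\<close>
      also have "(\<Prod>s\<in>{1..m}. w (js ! idx s) \<omega>) = (\<Prod>i<k. \<Prod>s\<in>{s\<in>{1..m}. idx s = i}. w (js ! idx s) \<omega>)"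
        using idx(1) by (intro prod.group[symmetric]) auto
      also have "\<dots> = (\<Prod>i<k. w (js ! i) \<omega> ^ card (Bs ! i))"
        by (rule prod.cong) (auto simp: Bs_idx)
      also have "\<dots> = (\<Prod>i<length ns. w (js ! i) \<omega> ^ (ns ! i))"
        by (simp add: ns_def k_def)
      finally show ?thesis .
    qed
    then have "weight m (\<phi> js) = (\<integral>\<^sup>+\<omega>. ennreal (\<Prod>i<length ns. w (js ! i) \<omega> ^ (ns ! i)) \<partial>P)"
      unfolding weight_def by (intro nn_integral_cong)
    also have "\<dots> = ennreal (\<integral>\<omega>. (\<Prod>i<length ns. w (js ! i) \<omega> ^ (ns ! i)) \<partial>P)"
    proof (rule nn_integral_eq_integral)
      have "AE \<omega> in P. norm (\<Prod>i<length ns. w (js ! i) \<omega> ^ (ns ! i)) \<le> 1"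
        using AE_w_le_1
      proof (rule AE_mp, intro AE_I2 impI)
        fix \<omega> assume "\<omega> \<in> space P" "\<forall>j. w j \<omega> \<le> 1"
        then show "norm (\<Prod>i<length ns. w (js ! i) \<omega> ^ (ns ! i)) \<le> 1"
          using w_nonneg by (auto simp: abs_prod intro!: prod_le_1 power_le_one)
      qed
      then show "integrable P (\<lambda>\<omega>. \<Prod>i<length ns. w (js ! i) \<omega> ^ (ns ! i))"
        by (intro integrable_const_bound[where B=1]) auto
      show "AE \<omega> in P. 0 \<le> (\<Prod>i<length ns. w (js ! i) \<omega> ^ (ns ! i))"
        using w_nonneg by (intro AE_I2 prod_nonneg) auto
    qed
    finally show ?thesis .
  qed
  have hs: "((\<lambda>js. \<integral>\<omega>. (\<Prod>i<length ns. w (js ! i) \<omega> ^ (ns ! i)) \<partial>P) has_sum q0 (mset ns)) ?J"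
  proof -
    have "\<rho> \<noteq> {}" using partition_onD1[OF \<rho>] m by auto
    then have "ns \<noteq> []" using Bs by (auto simp: ns_def)
    moreover have "0 < n" if "n \<in> set ns" for n
      using that B(2,3) by (auto simp: ns_def in_set_conv_nth k_def card_gt_0_iff)
    ultimately show ?thesis using q0_sum[of ns] by (simp add: ns_def k_def)
  qed
  have nonneg: "0 \<le> (\<integral>\<omega>. (\<Prod>i<length ns. w (js ! i) \<omega> ^ (ns ! i)) \<partial>P)" for js
    using w_nonneg by (intro integral_nonneg_AE AE_I2 prod_nonneg) auto
  have "emeasure (labels m) ?K = (\<integral>\<^sup>+f. weight m f \<partial>count_space ?K)"
  proof -
    have "emeasure (labels m) ?K = (\<integral>\<^sup>+f. weight m f * indicator ?K f \<partial>count_space ({1..m} \<rightarrow>\<^sub>E UNIV))"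
      unfolding labels_def by (rule emeasure_density) auto
    also have "\<dots> = (\<integral>\<^sup>+f. weight m f \<partial>count_space ?K)"
      by (subst (1 2) nn_integral_count_space_indicator) (auto intro!: nn_integral_cong simp: indicator_def)
    finally show ?thesis .
  qed
  also have "\<dots> = (\<integral>\<^sup>+js. weight m (\<phi> js) \<partial>count_space ?J)"
    by (rule nn_integral_bij_count_space[OF bij, symmetric])
  also have "\<dots> = (\<integral>\<^sup>+js. ennreal (\<integral>\<omega>. (\<Prod>i<length ns. w (js ! i) \<omega> ^ (ns ! i)) \<partial>P) \<partial>count_space ?J)"
    by (intro nn_integral_cong weight_\<phi>) simp
  also have "\<dots> = ennreal (q0 (mset ns))"
  proof -
    \<comment> \<open>A real \<open>has_sum\<close> converges absolutely; as its terms are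
      nonnegative, it agrees with the integral against the counting measure.\<close>
    have abs: "Infinite_Set_Sum.abs_summable_on
        (\<lambda>js. \<integral>\<omega>. (\<Prod>i<length ns. w (js ! i) \<omega> ^ (ns ! i)) \<partial>P) ?J"
      by (rule abs_summable_equivalent[THEN iffD1,
            OF summable_on_iff_abs_summable_on_real[THEN iffD1, OF has_sum_imp_summable[OF hs]]])
    show ?thesis
      using nn_integral_conv_infsetsum[OF abs nonneg] infsetsum_infsum[OF abs] infsumI[OF hs] by simp
  qed
  finally have "measure (labels m) ?K = q0 (mset ns)"
    using has_sum_nonneg[OF hs nonneg] by (simp add: measure_def)
  also have "mset ns = image_mset card (mset_set \<rho>)"
    using Bs mset_set_set[of Bs] by (simp add: ns_def)
  finally show ?thesis by (simp add: at_partition_def)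
qed

lemma prob_labels_card:
  assumes m: "1 \<le> m"
  shows "measure (labels m) {f \<in> {1..m} \<rightarrow>\<^sub>E UNIV. card (f ` {1..m}) = k} = block_count_prob q0 m k"
proof -
  interpret V: prob_space "labels m" by (rule prob_space_labels)
  let ?K = "\<lambda>\<rho>. {f \<in> {1..m} \<rightarrow>\<^sub>E (UNIV::nat set). fibres {1..m} f = \<rho>}"
  have fib: "fibres {1..m} f \<in> partitions m" "card (fibres {1..m} f) = card (f ` {1..m})" for f :: "nat \<Rightarrow> nat"
    using partition_on_fibres[of "{1..m}" f] card_fibres[of "{1..m}" f] by (simp_all add: partitions_def)
  have "{f \<in> {1..m} \<rightarrow>\<^sub>E UNIV. card (f ` {1..m}) = k} = (\<Union>\<rho>\<in>{\<rho>\<in>partitions m. card \<rho> = k}. ?K \<rho>)"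
    unfolding fib(2)[symmetric] using fib(1) by blast
  then have "measure (labels m) {f \<in> {1..m} \<rightarrow>\<^sub>E UNIV. card (f ` {1..m}) = k} =
      measure (labels m) (\<Union>\<rho>\<in>{\<rho>\<in>partitions m. card \<rho> = k}. ?K \<rho>)" by (rule arg_cong)
  also have "\<dots> = (\<Sum>\<rho>\<in>{\<rho>\<in>partitions m. card \<rho> = k}. measure (labels m) (?K \<rho>))"
    by (rule V.finite_measure_finite_Union) (auto simp: finite_partitions disjoint_family_on_def)
  also have "\<dots> = block_count_prob q0 m k"
    unfolding block_count_prob_def using m
    by (intro sum.cong prob_labels_kernel) (auto simp: partitions_def)
  finally show ?thesis .
qed

end

lemma sets_card_image_eq:
  assumes "finite L"
  shows "{x \<in> space (PiM L (\<lambda>_. borel :: 'x::{second_countable_topology, t2_space} measure)). card (x ` L) = d}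
    \<in> sets (PiM L (\<lambda>_. borel))"
proof -
  have "(\<lambda>x. card ((\<lambda>l. x l) ` L)) \<in> measurable (PiM L (\<lambda>_. borel :: 'x measure)) (count_space UNIV)"
    by (rule measurable_card_image[OF assms]) auto
  from measurable_sets[OF this, of "{d}"] show ?thesis
    by (simp add: vimage_def Int_def conj_commute)
qed

text \<open>Given the index map, the array displays the i.i.d. atoms of the indices in use, so only
  the number \<open>k\<close> of these indices matters. The bound \<open>K\<close> instead of
  \<open>m\<close> gives the sum the same range for all row partitions; the added terms vanish,
  since \<open>m\<close> blocks use at most \<open>m\<close> indices.\<close>

lemma (in species_sampling) prob_array_card:
  fixes \<tau> :: "'l \<Rightarrow> nat"
  assumes null: "\<And>x. x \<noteq> x0 \<Longrightarrow> emeasure H0 {x} = 0" and atom: "measure H0 {x0} = a"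
    and a: "0 \<le> a" "a \<le> 1"
    and L: "finite L" "L \<noteq> {}" "\<tau> ` L = {1..m}" and d: "1 \<le> d" and K: "m \<le> K"
  shows "measure (array_law m \<tau> L) {x \<in> space (PiM L (\<lambda>_. borel)). card (x ` L) = d} =
    (\<Sum>k=1..K. distinct_law a k d * block_count_prob q0 m k)"
proof -
  interpret V: prob_space "labels m" by (rule prob_space_labels)
  let ?E = "{x \<in> space (PiM L (\<lambda>_. borel)). card (x ` L) = d} :: ('l \<Rightarrow> 'x) set"
  let ?V = "\<lambda>k. {f \<in> {1..m} \<rightarrow>\<^sub>E (UNIV::nat set). card (f ` {1..m}) = k}"
  have m: "1 \<le> m" using L by (cases "m = 0") auto
  have dl: "0 \<le> distinct_law a k d" for k using a by (simp add: distinct_law_def)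
  note E = sets_card_image_eq[OF L(1), of d]
  have "emeasure (array_law m \<tau> L) ?E =
      (\<integral>\<^sup>+f. emeasure P {\<omega> \<in> space P. (\<lambda>l\<in>L. Z (f (\<tau> l)) \<omega>) \<in> ?E} \<partial>labels m)"
    by (rule emeasure_array_law[OF E])
  also have "\<dots> = (\<integral>\<^sup>+f. (\<Sum>k=1..K. ennreal (distinct_law a k d) * indicator (?V k) f) \<partial>labels m)"
  proof (rule nn_integral_cong)
    fix f assume f: "f \<in> space (labels m)"
    have "(\<lambda>l\<in>L. Z (f (\<tau> l)) \<omega>) ` L = (\<lambda>j. Z j \<omega>) ` (f ` {1..m})" for \<omega>
      unfolding L(3)[symmetric] by (simp add: image_image)
    then have "{\<omega> \<in> space P. (\<lambda>l\<in>L. Z (f (\<tau> l)) \<omega>) \<in> ?E} =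
        {\<omega> \<in> space P. card ((\<lambda>j. Z j \<omega>) ` (f ` {1..m})) = d}"
      by (auto simp: space_PiM)
    then have "emeasure P {\<omega> \<in> space P. (\<lambda>l\<in>L. Z (f (\<tau> l)) \<omega>) \<in> ?E} =
        ennreal (prob {\<omega> \<in> space P. card ((\<lambda>j. Z j \<omega>) ` (f ` {1..m})) = d})"
      by (simp add: emeasure_eq_measure)
    also have "prob {\<omega> \<in> space P. card ((\<lambda>j. Z j \<omega>) ` (f ` {1..m})) = d} = distinct_law a (card (f ` {1..m})) d"
      using m d by (intro prob_card_iid_atom[OF indep_vars_subset[OF Z_indep] _ _ _ Z_law null atom]) auto
    also have "ennreal \<dots> = (\<Sum>k\<in>{card (f ` {1..m})}. ennreal (distinct_law a k d) * indicator (?V k) f)"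
      using f by simp
    also have "\<dots> = (\<Sum>k=1..K. ennreal (distinct_law a k d) * indicator (?V k) f)"
    proof (rule sum.mono_neutral_left)
      have "card (f ` {1..m}) \<le> K" using card_image_le[of "{1..m}" f] K by simp
      moreover have "1 \<le> card (f ` {1..m})" using m by (simp add: Suc_le_eq card_gt_0_iff)
      ultimately show "{card (f ` {1..m})} \<subseteq> {1..K}" by simp
    qed auto
    finally show "emeasure P {\<omega> \<in> space P. (\<lambda>l\<in>L. Z (f (\<tau> l)) \<omega>) \<in> ?E} =
        (\<Sum>k=1..K. ennreal (distinct_law a k d) * indicator (?V k) f)" .
  qed
  also have "\<dots> = (\<Sum>k=1..K. ennreal (distinct_law a k d) * emeasure (labels m) (?V k))"
  proof -
    have V: "?V k \<in> sets (labels m)" for k by auto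
    show ?thesis
      by (subst nn_integral_sum) (simp_all only: nn_integral_cmult_indicator[OF V]
        borel_measurable_times_ennreal borel_measurable_const borel_measurable_indicator[OF V])
  qed
  also have "\<dots> = ennreal (\<Sum>k=1..K. distinct_law a k d * measure (labels m) (?V k))"
    using dl by (simp add: V.emeasure_eq_measure ennreal_mult[symmetric] sum_ennreal)
  finally have "measure (array_law m \<tau> L) ?E = (\<Sum>k=1..K. distinct_law a k d * measure (labels m) (?V k))"
    using dl by (simp add: measure_def sum_nonneg)
  then show ?thesis by (simp only: prob_labels_card[OF m])
qed

section \<open>Laws of hierarchical arrays and of latent cluster numbers\<close>

text \<open>Blocks are numbered as pairs of a row and a set: the same set of columns may be a block
  in several rows, and these blocks pick their indices separately. The product formula holds for
  every \<open>g\<close>, so that it applies pointwise to the random masses inside an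
  integral.\<close>

lemma partition_labelling:
  fixes n :: "nat \<Rightarrow> nat" and \<pi> :: "nat \<Rightarrow> nat set set"
  assumes S: "finite S" and \<pi>: "\<And>i. i \<in> S \<Longrightarrow> partition_on {1..n i} (\<pi> i)"
  obtains \<tau> where "\<tau> ` (SIGMA i:S. {1..n i}) = {1..\<Sum>i\<in>S. card (\<pi> i)}"
    and "\<And>g :: (nat \<times> nat) set \<Rightarrow> real. (\<Prod>i\<in>S. \<Prod>B\<in>\<pi> i. g ({i} \<times> B)) =
      (\<Prod>s\<in>{1..\<Sum>i\<in>S. card (\<pi> i)}. g {l\<in>(SIGMA i:S. {1..n i}). \<tau> l = s})"
proof -
  let ?m = "\<Sum>i\<in>S. card (\<pi> i)" and ?C = "Sigma S \<pi>" and ?L = "SIGMA i:S. {1..n i}"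
  have fin: "finite (\<pi> i)" if "i \<in> S" for i using finite_elements[OF _ \<pi>[OF that]] by simp
  then have "finite ?C" "card ?C = ?m" using S by auto
  then obtain b where b: "bij_betw b ?C {1..?m}"
    by (metis card_atLeastAtMost diff_Suc_1 finite_atLeastAtMost finite_same_card_bij)
  have uniq: "B = B'" if "i \<in> S" "B \<in> \<pi> i" "B' \<in> \<pi> i" "j \<in> B" "j \<in> B'" for i B B' j
    using partition_onD2[OF \<pi>[OF that(1)]] that by (auto dest: disjointD)
  define block where "block l = (THE B. B \<in> \<pi> (fst l) \<and> snd l \<in> B)" for l
  have block: "block l \<in> \<pi> (fst l) \<and> snd l \<in> block l" if "l \<in> ?L" for l
  proof -
    have i: "fst l \<in> S" "snd l \<in> {1..n (fst l)}" using that by auto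
    then obtain B where B: "B \<in> \<pi> (fst l)" "snd l \<in> B" using partition_onD1[OF \<pi>] by blast
    then have "\<exists>!B. B \<in> \<pi> (fst l) \<and> snd l \<in> B" using uniq[OF i(1)] by blast
    then show ?thesis unfolding block_def by (rule theI')
  qed
  have block_eq: "block (i, j) = B" if "i \<in> S" "B \<in> \<pi> i" "j \<in> B" for i j B
  proof -
    have "j \<in> {1..n i}" using partition_onD1[OF \<pi>[OF that(1)]] that by blast
    then have "block (i, j) \<in> \<pi> i" "j \<in> block (i, j)" using block[of "(i, j)"] that(1) by auto
    then show ?thesis using uniq that by blast
  qed
  define \<tau> where "\<tau> l = b (fst l, block l)" for l
  \<comment> \<open>This rests on the injectivity of \<open>b\<close> and the disjointness of the
    blocks of one row.\<close>
  have fibre: "{l\<in>?L. \<tau> l = b (i, B)} = {i} \<times> B" if iB: "i \<in> S" "B \<in> \<pi> i" for i B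
  proof (intro set_eqI iffI)
    fix l assume l: "l \<in> {l\<in>?L. \<tau> l = b (i, B)}"
    then have "(fst l, block l) \<in> ?C" using block[of l] by auto
    then have "(fst l, block l) = (i, B)"
      using l iB bij_betw_imp_inj_on[OF b] by (intro inj_onD[of b ?C]) (auto simp: \<tau>_def)
    then show "l \<in> {i} \<times> B" using block[of l] l by (cases l) auto
  next
    fix l assume l: "l \<in> {i} \<times> B"
    then have "block l = B" using block_eq[OF iB] by auto
    moreover have "snd l \<in> {1..n i}" using partition_onD1[OF \<pi>[OF iB(1)]] l iB by auto
    ultimately show "l \<in> {l\<in>?L. \<tau> l = b (i, B)}" using l iB by (auto simp: \<tau>_def)
  qed
  show ?thesis
  proof
    show "\<tau> ` ?L = {1..?m}"
    proof
      show "\<tau> ` ?L \<subseteq> {1..?m}"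
        using bij_betwE[OF b] block unfolding \<tau>_def by (auto simp del: atLeastAtMost_iff)
      show "{1..?m} \<subseteq> \<tau> ` ?L"
      proof
        fix s assume "s \<in> {1..?m}"
        then obtain i B where iB: "i \<in> S" "B \<in> \<pi> i" "s = b (i, B)"
          using bij_betw_imp_surj_on[OF b] by blast
        then obtain j where "j \<in> B" using partition_onD3[OF \<pi>[OF iB(1)]] by (metis all_not_in_conv)
        then have "(i, j) \<in> {l\<in>?L. \<tau> l = b (i, B)}" unfolding fibre[OF iB(1,2)] by simp
        then show "s \<in> \<tau> ` ?L" using iB(3) by (intro image_eqI[of _ _ "(i, j)"]) auto
      qed
    qed
    fix g :: "(nat \<times> nat) set \<Rightarrow> real"
    have "(\<Prod>i\<in>S. \<Prod>B\<in>\<pi> i. g ({i} \<times> B)) = (\<Prod>(i, B)\<in>?C. g ({i} \<times> B))"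
      using S fin by (intro prod.Sigma) auto
    also have "\<dots> = (\<Prod>c\<in>?C. g {l\<in>?L. \<tau> l = b c})"
    proof (intro prod.cong refl)
      fix c assume "c \<in> ?C"
      then obtain i B where "i \<in> S" "B \<in> \<pi> i" "c = (i, B)" by blast
      then show "(case c of (i, B) \<Rightarrow> g ({i} \<times> B)) = g {l\<in>?L. \<tau> l = b c}"
        by (simp only: fibre prod.case)
    qed
    also have "\<dots> = (\<Prod>s\<in>{1..?m}. g {l\<in>?L. \<tau> l = s})"
      by (rule prod.reindex_bij_betw[OF b])
    finally show "(\<Prod>i\<in>S. \<Prod>B\<in>\<pi> i. g ({i} \<times> B)) = (\<Prod>s\<in>{1..?m}. g {l\<in>?L. \<tau> l = s})" .
  qed
qed

section \<open>Distinct values in a set of rows of an HSSM\<close>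

lemma SSrp_imp_species_sampling:
  assumes "SSrp P p q0 H0"
  shows "\<exists>w Z. species_sampling P w Z p q0 H0"
  using assms unfolding SSrp_def
  apply (elim conjE exE)
  subgoal for w Z
    by (intro exI[of _ w] exI[of _ Z] species_sampling.intro species_sampling_axioms.intro) blast+
  done

text \<open>The law \<open>\<mu>\<close> of the rows in \<open>S\<close> agrees on rectangles with a
  mixture of the laws \<open>array_law\<close>, hence on all events, and the count is known in each
  component. The sum runs over partitions of all rows although only those in \<open>S\<close> are
  observed, which is also the form of \<open>prob_latent_count\<close>.\<close>

lemma HSSM_distinct_law:
  fixes \<xi> :: "nat \<Rightarrow> nat \<Rightarrow> 'a \<Rightarrow> 'x::polish_space" and n :: "nat \<Rightarrow> nat"
  assumes \<xi>: "HSSM M I \<xi> q q0 H0"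
    and n: "\<And>i. i \<in> {1..I} \<Longrightarrow> 1 \<le> n i" and S: "S \<subseteq> {1..I}" "S \<noteq> {}"
    and null: "\<And>x. x \<noteq> x0 \<Longrightarrow> emeasure H0 {x} = 0" and atom: "measure H0 {x0} = a"
    and a: "0 \<le> a" "a \<le> 1" and d: "1 \<le> d"
  shows "measure M {\<omega> \<in> space M. card ((\<lambda>(i, j). \<xi> i j \<omega>) ` (SIGMA i:S. {1..n i})) = d} =
    (\<Sum>\<pi>\<in>(\<Pi>\<^sub>E i\<in>{1..I}. partitions (n i)). (\<Prod>i\<in>{1..I}. at_partition q (\<pi> i)) *
      (\<Sum>k=1..(\<Sum>i\<in>S. n i). distinct_law a k d * block_count_prob q0 (\<Sum>i\<in>S. card (\<pi> i)) k))"
proof -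
  interpret M: prob_space M using \<xi> by (simp add: HSSM_def)
  have \<xi>_meas: "\<xi> i j \<in> borel_measurable M" if "i \<in> {1..I}" "j \<ge> 1" for i j
    using \<xi> that by (simp add: HSSM_def)
  obtain P :: "((nat \<Rightarrow> real) \<times> (nat \<Rightarrow> 'x)) measure" and p where SS: "SSrp P p q0 H0"
    and rect: "\<And>(n :: nat \<Rightarrow> nat) (A :: nat \<Rightarrow> nat \<Rightarrow> 'x set).
           (\<forall>i\<in>{1..I}. 1 \<le> n i) \<Longrightarrow> (\<forall>i\<in>{1..I}. \<forall>j\<in>{1..n i}. A i j \<in> sets borel) \<Longrightarrow>
           measure M {\<omega> \<in> space M. \<forall>i\<in>{1..I}. \<forall>j\<in>{1..n i}. \<xi> i j \<omega> \<in> A i j} =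
           (\<Sum>\<pi>\<in>(\<Pi>\<^sub>E i\<in>{1..I}. partitions (n i)).
              (\<Prod>i\<in>{1..I}. at_partition q (\<pi> i)) *
              (\<integral>\<omega>. (\<Prod>i\<in>{1..I}. \<Prod>B\<in>\<pi> i. measure (p \<omega>) (\<Inter>j\<in>B. A i j)) \<partial>P))"
    using \<xi> unfolding HSSM_def by blast
  from SSrp_imp_species_sampling[OF SS] obtain w Z where "species_sampling P w Z p q0 H0" by blast
  then interpret species_sampling P w Z p q0 H0 .
  let ?L = "SIGMA i:S. {1..n i}" and ?\<Theta> = "\<Pi>\<^sub>E i\<in>{1..I}. partitions (n i)"
  let ?m = "\<lambda>\<pi>. \<Sum>i\<in>S. card (\<pi> i :: nat set set)"
  let ?c = "\<lambda>\<pi>. \<Prod>i\<in>{1..I}. at_partition q (\<pi> i)"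
  have finS: "finite S" using S by (auto intro: finite_subset)
  then have finL: "finite ?L" by simp
  have part: "partition_on {1..n i} (\<pi> i)" if "\<pi> \<in> ?\<Theta>" "i \<in> {1..I}" for \<pi> i
    using that by (auto simp: partitions_def)
  \<comment> \<open>Packs the two properties of a block numbering into one predicate, so that a
    numbering can be chosen for every \<open>\<pi>\<close> at once.\<close>
  define is_labelling where "is_labelling \<pi> \<tau> \<longleftrightarrow> \<tau> ` ?L = {1..?m \<pi>} \<and> (\<forall>g :: (nat \<times> nat) set \<Rightarrow> real.
      (\<Prod>i\<in>S. \<Prod>B\<in>\<pi> i. g ({i} \<times> B)) = (\<Prod>s\<in>{1..?m \<pi>}. g {l\<in>?L. \<tau> l = s}))" for \<pi> \<tau>
  have "\<exists>\<tau>. is_labelling \<pi> \<tau>" if \<pi>: "\<pi> \<in> ?\<Theta>" for \<pi>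
  proof -
    have "partition_on {1..n i} (\<pi> i)" if "i \<in> S" for i
      using part[OF \<pi>] S(1) that by blast
    then show ?thesis
    proof (rule partition_labelling[OF finS])
      fix \<tau> assume 1: "\<tau> ` ?L = {1..?m \<pi>}"
        and 2: "\<And>g :: (nat \<times> nat) set \<Rightarrow> real. (\<Prod>i\<in>S. \<Prod>B\<in>\<pi> i. g ({i} \<times> B)) =
          (\<Prod>s\<in>{1..?m \<pi>}. g {l\<in>?L. \<tau> l = s})"
      show ?thesis unfolding is_labelling_def by (intro exI[of _ \<tau>] conjI allI 1 2)
    qed
  qed
  then have "\<forall>\<pi>\<in>?\<Theta>. \<exists>\<tau>. is_labelling \<pi> \<tau>" by blast
  from bchoice[OF this] obtain \<tau> where labelling: "\<forall>\<pi>\<in>?\<Theta>. is_labelling \<pi> (\<tau> \<pi>)" by blast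
  have \<tau>: "\<tau> \<pi> ` ?L = {1..?m \<pi>}" if "\<pi> \<in> ?\<Theta>" for \<pi>
    using bspec[OF labelling that] unfolding is_labelling_def by (rule conjunct1)
  have prod_\<tau>: "(\<Prod>i\<in>S. \<Prod>B\<in>\<pi> i. (g :: (nat \<times> nat) set \<Rightarrow> real) ({i} \<times> B)) =
        (\<Prod>s\<in>{1..?m \<pi>}. g {l\<in>?L. \<tau> \<pi> l = s})"
    if "\<pi> \<in> ?\<Theta>" for \<pi> g
    using bspec[OF labelling that] unfolding is_labelling_def by (elim conjE allE)
  define X where "X \<omega> = (\<lambda>l\<in>?L. \<xi> (fst l) (snd l) \<omega>)" for \<omega>
  define \<mu> where "\<mu> = distr M (PiM ?L (\<lambda>_. borel)) X"
  have X: "X \<in> measurable M (PiM ?L (\<lambda>_. borel))"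
    unfolding X_def using S(1) by (intro measurable_restrict \<xi>_meas) auto
  have \<mu>: "prob_space \<mu>" unfolding \<mu>_def by (rule M.prob_space_distr[OF X])
  let ?G = "{Pi\<^sub>E ?L A |A. \<forall>l\<in>?L. A l \<in> sets (borel :: 'x measure)}"
  have mix: "measure \<mu> E = (\<Sum>\<pi>\<in>?\<Theta>. ?c \<pi> * measure (array_law (?m \<pi>) (\<tau> \<pi>) ?L) E)"
    if E: "E \<in> sets \<mu>" for E
  proof (rule measure_eq_mixture[OF \<mu> _ _ _ _ _ _ _ _ E, where G="?G"])
    show "finite ?\<Theta>" by (intro finite_PiE finite_partitions) simp
    show "sets \<mu> = sigma_sets (space \<mu>) ?G"
    proof -
      have "prod_algebra ?L (\<lambda>_. borel :: 'x measure) = ?G"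
        unfolding prod_algebra_eq_finite[OF finL] by (auto simp: Pi_iff)
      then show ?thesis by (simp add: \<mu>_def sets_PiM space_PiM)
    qed
    show "Int_stable ?G" by (rule Int_stable_PiE)
    show "?G \<subseteq> Pow (space \<mu>)" by (auto simp: \<mu>_def space_PiM)
    show "space \<mu> \<in> ?G" by (auto simp: \<mu>_def space_PiM intro!: exI[of _ "\<lambda>_. UNIV"])
    fix E assume "E \<in> ?G"
    then obtain A where EA: "E = Pi\<^sub>E ?L A" and A: "\<forall>l\<in>?L. A l \<in> sets borel" by blast
    \<comment> \<open>Rows outside \<open>S\<close> are left unconstrained, which turns the
      rectangle on \<open>S\<close> into one on all rows, as the HSSM formula demands.\<close>
    define A' where "A' i j = (if i \<in> S then A (i, j) else UNIV)" for i j
    have "E \<in> sets (PiM ?L (\<lambda>_. borel))" unfolding EA using A finL by (intro sets_PiM_I_finite) auto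
    then have "measure \<mu> E = measure M (X -` E \<inter> space M)"
      unfolding \<mu>_def by (rule measure_distr[OF X])
    also have "X -` E \<inter> space M = {\<omega> \<in> space M. \<forall>i\<in>{1..I}. \<forall>j\<in>{1..n i}. \<xi> i j \<omega> \<in> A' i j}"
    proof -
      have "X \<omega> \<in> E \<longleftrightarrow> (\<forall>i\<in>S. \<forall>j\<in>{1..n i}. \<xi> i j \<omega> \<in> A (i, j))" for \<omega>
        unfolding EA X_def by (simp add: PiE_iff)
      then have "X \<omega> \<in> E \<longleftrightarrow> (\<forall>i\<in>{1..I}. \<forall>j\<in>{1..n i}. \<xi> i j \<omega> \<in> A' i j)" for \<omega>
        using S(1) unfolding A'_def by (simp only: if_split) blast
      then show ?thesis by blast
    qed
    also have "measure M \<dots> = (\<Sum>\<pi>\<in>?\<Theta>. ?c \<pi> *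
        (\<integral>\<omega>. (\<Prod>i\<in>{1..I}. \<Prod>B\<in>\<pi> i. measure (p \<omega>) (\<Inter>j\<in>B. A' i j)) \<partial>P))"
      using n A by (intro rect) (auto simp: A'_def)
    also have "\<dots> = (\<Sum>\<pi>\<in>?\<Theta>. ?c \<pi> * measure (array_law (?m \<pi>) (\<tau> \<pi>) ?L) E)"
    proof (intro sum.cong refl arg_cong2[where f="(*)"])
      fix \<pi> assume \<pi>: "\<pi> \<in> ?\<Theta>"
      have ne: "B \<noteq> {}" "B \<subseteq> {1..n i}" "finite B" if "i \<in> {1..I}" "B \<in> \<pi> i" for i B
      proof -
        show "B \<noteq> {}" "B \<subseteq> {1..n i}"
          using partition_onD3[OF part[OF \<pi> that(1)]] partition_onD1[OF part[OF \<pi> that(1)]] that by auto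
        then show "finite B" by (auto dest: finite_subset)
      qed
      have Am: "(\<Inter>j\<in>B. A' i j) \<in> sets borel" if "i \<in> {1..I}" "B \<in> \<pi> i" for i B
      proof -
        have "A' i j \<in> sets borel" if "j \<in> B" for j
          using A ne[OF \<open>i \<in> {1..I}\<close> \<open>B \<in> \<pi> i\<close>] that by (auto simp: A'_def)
        then show ?thesis using ne[OF that] by (intro sets.finite_INT) auto
      qed
      have "(\<integral>\<omega>. (\<Prod>i\<in>{1..I}. \<Prod>B\<in>\<pi> i. measure (p \<omega>) (\<Inter>j\<in>B. A' i j)) \<partial>P) =
          (\<integral>\<omega>. (\<Prod>i\<in>S. \<Prod>B\<in>\<pi> i. measure (p \<omega>) (\<Inter>j\<in>B. A' i j)) \<partial>P)"
      proof (rule integral_cong_AE)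
        show "AE \<omega> in P. (\<Prod>i\<in>{1..I}. \<Prod>B\<in>\<pi> i. measure (p \<omega>) (\<Inter>j\<in>B. A' i j)) =
            (\<Prod>i\<in>S. \<Prod>B\<in>\<pi> i. measure (p \<omega>) (\<Inter>j\<in>B. A' i j))"
          using AE_prob_space_p
        proof (rule AE_mp, intro AE_I2 impI)
          fix \<omega> assume \<omega>: "\<omega> \<in> space P" "prob_space (p \<omega>)"
          \<comment> \<open>Each block of an unconstrained row contributes the total mass of
            \<open>p \<omega>\<close> as a factor.\<close>
          have U: "measure (p \<omega>) UNIV = 1"
            using prob_space.prob_space[OF \<omega>(2)] sets_eq_imp_space_eq[OF sets_p[OF \<omega>(1)]] by simp
          show "(\<Prod>i\<in>{1..I}. \<Prod>B\<in>\<pi> i. measure (p \<omega>) (\<Inter>j\<in>B. A' i j)) =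
            (\<Prod>i\<in>S. \<Prod>B\<in>\<pi> i. measure (p \<omega>) (\<Inter>j\<in>B. A' i j))"
          proof (rule prod.mono_neutral_right[OF _ S(1)])
            show "\<forall>i\<in>{1..I} - S. (\<Prod>B\<in>\<pi> i. measure (p \<omega>) (\<Inter>j\<in>B. A' i j)) = 1"
            proof
              fix i assume i: "i \<in> {1..I} - S"
              have "(\<Inter>j\<in>B. A' i j) = UNIV" for B
                using i by (auto simp: A'_def)
              then show "(\<Prod>B\<in>\<pi> i. measure (p \<omega>) (\<Inter>j\<in>B. A' i j)) = 1" using U by simp
            qed
          qed simp
        qed
      qed (use Am S(1) in \<open>intro borel_measurable_prod measurable_p; blast\<close>)+
      also have "\<dots> = (\<integral>\<omega>. (\<Prod>i\<in>S. \<Prod>B\<in>\<pi> i. measure (p \<omega>) (\<Inter>l\<in>{i} \<times> B. A l)) \<partial>P)"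
      proof -
        have "(\<Inter>j\<in>B. A' i j) = (\<Inter>l\<in>{i} \<times> B. A l)" if "i \<in> S" for i B
          using that by (auto simp: A'_def)
        then show ?thesis by simp
      qed
      also have "\<dots> = (\<integral>\<omega>. (\<Prod>s\<in>{1..?m \<pi>}. measure (p \<omega>) (\<Inter>l\<in>{l\<in>?L. \<tau> \<pi> l = s}. A l)) \<partial>P)"
        using prod_\<tau>[OF \<pi>, of "\<lambda>C. measure (p _) (\<Inter>l\<in>C. A l)"] by simp
      also have "\<dots> = measure (array_law (?m \<pi>) (\<tau> \<pi>) ?L) (Pi\<^sub>E ?L A)"
        using finL \<tau>[OF \<pi>] A by (intro integral_prod_random_measure) auto
      finally show "(\<integral>\<omega>. (\<Prod>i\<in>{1..I}. \<Prod>B\<in>\<pi> i. measure (p \<omega>) (\<Inter>j\<in>B. A' i j)) \<partial>P) =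
          measure (array_law (?m \<pi>) (\<tau> \<pi>) ?L) E" by (simp only: EA)
    qed
    finally show "measure \<mu> E = (\<Sum>\<pi>\<in>?\<Theta>. ?c \<pi> * measure (array_law (?m \<pi>) (\<tau> \<pi>) ?L) E)" .
  qed (auto simp: prob_space_array_law \<mu>_def)
  let ?E = "{x \<in> space (PiM ?L (\<lambda>_. borel :: 'x measure)). card (x ` ?L) = d}"
  have E: "?E \<in> sets (PiM ?L (\<lambda>_. borel))" by (rule sets_card_image_eq[OF finL])
  have "X \<omega> ` ?L = (\<lambda>(i, j). \<xi> i j \<omega>) ` ?L" for \<omega>
    unfolding X_def by (intro image_cong) auto
  then have "{\<omega> \<in> space M. card ((\<lambda>(i, j). \<xi> i j \<omega>) ` ?L) = d} = X -` ?E \<inter> space M"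
    using measurable_space[OF X] by auto
  then have "measure M {\<omega> \<in> space M. card ((\<lambda>(i, j). \<xi> i j \<omega>) ` ?L) = d} = measure \<mu> ?E"
    unfolding \<mu>_def by (simp only: measure_distr[OF X E])
  also have "\<dots> = (\<Sum>\<pi>\<in>?\<Theta>. ?c \<pi> * measure (array_law (?m \<pi>) (\<tau> \<pi>) ?L) ?E)"
    by (rule mix) (simp only: \<mu>_def sets_distr E)
  also have "\<dots> = (\<Sum>\<pi>\<in>?\<Theta>. ?c \<pi> * (\<Sum>k=1..(\<Sum>i\<in>S. n i). distinct_law a k d * block_count_prob q0 (?m \<pi>) k))"
  proof (intro sum.cong refl arg_cong2[where f="(*)"]
      prob_array_card[where ?x0.0=x0] a d finL)
    fix \<pi> assume \<pi>: "\<pi> \<in> ?\<Theta>"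
    show "\<tau> \<pi> ` ?L = {1..?m \<pi>}" by (rule \<tau>[OF \<pi>])
    obtain i where "i \<in> S" using S(2) by blast
    then have "(i, 1) \<in> ?L" using n[of i] S(1) by auto
    then show "?L \<noteq> {}" by blast
    show "?m \<pi> \<le> (\<Sum>i\<in>S. n i)"
      using card_partition_le[OF _ part[OF \<pi>]] S(1) by (intro sum_mono) force
  qed (use null atom in auto)
  finally show ?thesis .
qed

lemma (in prob_space) expectation_nat_valued:
  fixes h :: "nat \<Rightarrow> real"
  assumes D: "D \<in> measurable M (count_space UNIV)" "\<And>\<omega>. \<omega> \<in> space M \<Longrightarrow> D \<omega> \<in> {1..K}"
  shows "(\<integral>\<omega>. h (D \<omega>) \<partial>M) = (\<Sum>k=1..K. h k * prob {\<omega> \<in> space M. D \<omega> = k})"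
proof -
  have E: "{\<omega> \<in> space M. D \<omega> = k} \<in> events" for k
    using measurable_sets[OF D(1), of "{k}"] by (simp add: vimage_def Int_def conj_commute)
  have "(\<integral>\<omega>. h (D \<omega>) \<partial>M) = (\<integral>\<omega>. (\<Sum>k=1..K. h k * indicator {\<omega> \<in> space M. D \<omega> = k} \<omega>) \<partial>M)"
  proof (rule Bochner_Integration.integral_cong[OF refl])
    fix \<omega> assume \<omega>: "\<omega> \<in> space M"
    then have "(\<Sum>k=1..K. h k * indicator {\<omega> \<in> space M. D \<omega> = k} \<omega>) = (\<Sum>k=1..K. if D \<omega> = k then h k else 0)"
      by (intro sum.cong) auto
    then show "h (D \<omega>) = (\<Sum>k=1..K. h k * indicator {\<omega> \<in> space M. D \<omega> = k} \<omega>)"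
      using D(2)[OF \<omega>] by simp
  qed
  also have "\<dots> = (\<Sum>k=1..K. \<integral>\<omega>. h k * indicator {\<omega> \<in> space M. D \<omega> = k} \<omega> \<partial>M)"
    using E by (intro Bochner_Integration.integral_sum integrable_mult_right integrable_real_indicator)
      (auto simp: less_top[symmetric])
  also have "\<dots> = (\<Sum>k=1..K. h k * prob {\<omega> \<in> space M. D \<omega> = k})"
    using E by simp
  finally show ?thesis .
qed

section \<open>Law of the latent cluster number\<close>

lemma card_partition_pos:
  assumes "\<rho> \<in> partitions m" "1 \<le> m"
  shows "1 \<le> card \<rho>"
proof -
  have "partition_on {1..m} \<rho>" using assms(1) by (simp add: partitions_def)
  then have "finite \<rho>" "\<rho> \<noteq> {}"
    using finite_elements[of "{1..m}" \<rho>] partition_onD1[of "{1..m}" \<rho>] assms(2) by auto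
  then show ?thesis by (simp add: Suc_le_eq card_gt_0_iff)
qed

lemma card_partitions_le: "\<rho> \<in> partitions m \<Longrightarrow> card \<rho> \<le> m"
  using card_partition_le[of "{1..m}" \<rho>] by (simp add: partitions_def)

context
  fixes N :: "'b measure" and I :: nat and R :: "nat \<Rightarrow> nat \<Rightarrow> 'b \<Rightarrow> nat set set"
    and q q0 :: symmetric_fun and n :: "nat \<Rightarrow> nat" and S :: "nat set"
  assumes R: "latent_partitions N I R q q0"
    and n: "\<And>i. i \<in> {1..I} \<Longrightarrow> 1 \<le> n i" and S: "S \<subseteq> {1..I}" "S \<noteq> {}"
begin

lemma measurable_latent:
  "i \<in> {0..I} \<Longrightarrow> R i m \<in> measurable N (count_space (partitions m))"
  using R by (cases "i = 0") (auto simp: latent_partitions_def has_EPPF_def exchangeable_random_partition_def)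

lemma latent_in_partitions:
  "i \<in> {0..I} \<Longrightarrow> \<omega> \<in> space N \<Longrightarrow> R i m \<omega> \<in> partitions m"
  using measurable_space[OF measurable_latent] by simp

text \<open>The size at which \<open>R 0\<close> is read is itself random; having countably many
  values, it may be substituted into the family \<open>card (R 0 m \<omega>)\<close>.\<close>

lemma measurable_latent_count:
  "(\<lambda>\<omega>. card (R 0 (\<Sum>i\<in>S. card (R i (n i) \<omega>)) \<omega>)) \<in> measurable N (count_space UNIV)"
proof (rule measurable_compose_countable[where f="\<lambda>m \<omega>. card (R 0 m \<omega>)"])
  have card: "(\<lambda>\<omega>. card (R i m \<omega>)) \<in> measurable N (count_space UNIV)" if "i \<in> {0..I}" for i m
    by (rule measurable_compose[OF measurable_latent[OF that]]) simp
  show "(\<lambda>\<omega>. card (R 0 m \<omega>)) \<in> measurable N (count_space UNIV)" for m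
    by (rule card) simp
  have [measurable]: "(\<lambda>\<omega>. card (R i (n i) \<omega>)) \<in> measurable N (count_space UNIV)" if "i \<in> S" for i
    using that S(1) by (intro card) auto
  show "(\<lambda>\<omega>. \<Sum>i\<in>S. card (R i (n i) \<omega>)) \<in> measurable N (count_space UNIV)"
    by measurable
qed

lemma latent_count_range:
  assumes \<omega>: "\<omega> \<in> space N"
  shows "card (R 0 (\<Sum>i\<in>S. card (R i (n i) \<omega>)) \<omega>) \<in> {1..\<Sum>i\<in>S. n i}"
proof -
  let ?m = "\<Sum>i\<in>S. card (R i (n i) \<omega>)"
  have finS: "finite S" using S(1) by (auto intro: finite_subset)
  have p: "R i (n i) \<omega> \<in> partitions (n i)" "1 \<le> n i" if "i \<in> S" for i
    using that S(1) n by (auto intro!: latent_in_partitions[OF _ \<omega>])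
  obtain i where i: "i \<in> S" using S(2) by blast
  have "1 \<le> card (R i (n i) \<omega>)" using card_partition_pos[OF p[OF i]] .
  also have "\<dots> \<le> ?m" using finS i by (intro member_le_sum) auto
  finally have "1 \<le> ?m" .
  moreover have "?m \<le> (\<Sum>i\<in>S. n i)" using p(1) by (intro sum_mono card_partitions_le)
  moreover have "R 0 ?m \<omega> \<in> partitions ?m" by (rule latent_in_partitions[OF _ \<omega>]) simp
  ultimately show ?thesis
    using card_partition_pos[of "R 0 ?m \<omega>" ?m] card_partitions_le[of "R 0 ?m \<omega>" ?m] by simp
qed

text \<open>Where the rows have given partitions \<open>\<pi>\<close>, the random size at which
  \<open>R 0\<close> is read is a constant, and independence of the top level from the rows applies.
  Splitting over the partitions of all rows, also those outside \<open>S\<close>, matches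
  \<open>HSSM_distinct_law\<close>.\<close>

lemma prob_latent_count:
  "measure N {\<omega> \<in> space N. card (R 0 (\<Sum>i\<in>S. card (R i (n i) \<omega>)) \<omega>) = k} =
    (\<Sum>\<pi>\<in>(\<Pi>\<^sub>E i\<in>{1..I}. partitions (n i)). (\<Prod>i\<in>{1..I}. at_partition q (\<pi> i)) *
      block_count_prob q0 (\<Sum>i\<in>S. card (\<pi> i)) k)"
proof -
  interpret prob_space N using R by (simp add: latent_partitions_def)
  let ?\<Theta> = "\<Pi>\<^sub>E i\<in>{1..I}. partitions (n i)"
  let ?m = "\<lambda>\<pi>. \<Sum>i\<in>S. card (\<pi> i :: nat set set)"
  let ?Q = "PiM UNIV (\<lambda>m. count_space (partitions m))"
  define Y where "Y = (\<lambda>i \<omega> m. R i m \<omega>)"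
  have finS: "finite S" using S(1) by (auto intro: finite_subset)
  have indep: "indep_vars (\<lambda>_. ?Q) Y {0..I}" using R by (simp add: latent_partitions_def Y_def)
  have eppf: "prob {\<omega> \<in> space N. R i (n i) \<omega> = \<rho>} = at_partition q \<rho>"
    if "i \<in> {1..I}" "\<rho> \<in> partitions (n i)" for i \<rho>
    using R n[OF that(1)] that by (auto simp: latent_partitions_def has_EPPF_def)
  have ev: "{\<omega> \<in> space N. R i m \<omega> \<in> C} \<in> events" if "i \<in> {0..I}" for i m C
  proof -
    have "R i m -` (C \<inter> partitions m) \<inter> space N \<in> events"
      by (rule measurable_sets[OF measurable_latent[OF that]]) simp
    also have "R i m -` (C \<inter> partitions m) \<inter> space N = {\<omega> \<in> space N. R i m \<omega> \<in> C}"
      using latent_in_partitions[OF that] by auto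
    finally show ?thesis .
  qed
  have count: "prob {\<omega> \<in> space N. card (R 0 m \<omega>) = k} = block_count_prob q0 m k" if m: "1 \<le> m" for m
  proof -
    have "{\<omega> \<in> space N. card (R 0 m \<omega>) = k} =
        (\<Union>\<rho>\<in>{\<rho>\<in>partitions m. card \<rho> = k}. {\<omega> \<in> space N. R 0 m \<omega> = \<rho>})"
      using latent_in_partitions[of 0] by auto
    also have "prob \<dots> = (\<Sum>\<rho>\<in>{\<rho>\<in>partitions m. card \<rho> = k}. prob {\<omega> \<in> space N. R 0 m \<omega> = \<rho>})"
      using ev[of 0 m "{_}"] finite_partitions[of m]
      by (intro finite_measure_finite_Union) (auto simp: disjoint_family_on_def)
    also have "\<dots> = block_count_prob q0 m k"
      unfolding block_count_prob_def using R m
      by (intro sum.cong) (auto simp: latent_partitions_def has_EPPF_def)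
    finally show ?thesis .
  qed
  define E where "E \<pi> = {\<omega> \<in> space N. (\<forall>i\<in>{1..I}. R i (n i) \<omega> = \<pi> i) \<and> card (R 0 (?m \<pi>) \<omega>) = k}" for \<pi>
  have E_prob: "E \<pi> \<in> events \<and> prob (E \<pi>) = (\<Prod>i\<in>{1..I}. at_partition q (\<pi> i)) * block_count_prob q0 (?m \<pi>) k"
    if \<pi>: "\<pi> \<in> ?\<Theta>" for \<pi>
  proof -
    have \<pi>i: "\<pi> i \<in> partitions (n i)" if "i \<in> {1..I}" for i using \<pi> that by blast
    \<comment> \<open>\<open>E \<pi>\<close> has to be an intersection over \<open>{0..I}\<close> of
      events on single members of the family: index 0 asks for \<open>k\<close> blocks at size
      \<open>?m \<pi>\<close>, and \<open>i \<ge> 1\<close> for the partition \<open>\<pi> i\<close>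
      at size \<open>n i\<close>.\<close>
    define C where "C i = (if i = 0 then {\<rho>. card \<rho> = k} else {\<pi> i})" for i
    define l where "l i = (if i = 0 then ?m \<pi> else n i)" for i
    \<comment> \<open>Independence concerns whole sequences of partitions, so a condition at one
      size becomes a cylinder of the product space.\<close>
    define A where "A i = (\<lambda>x. x (l i)) -` (C i \<inter> partitions (l i)) \<inter> space ?Q" for i
    have A: "A i \<in> sets ?Q" for i
      unfolding A_def by (rule measurable_sets[OF measurable_component_singleton]) auto
    have YA: "Y i -` A i \<inter> space N = {\<omega> \<in> space N. R i (l i) \<omega> \<in> C i}" if "i \<in> {0..I}" for i
      using latent_in_partitions[OF that] by (auto simp: Y_def A_def space_PiM)
    have split: "{0..I} = insert 0 {1..I}" by auto
    have "E \<pi> = (\<Inter>i\<in>{0..I}. {\<omega> \<in> space N. R i (l i) \<omega> \<in> C i})"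
      unfolding split by (auto simp: E_def C_def l_def)
    also have "\<dots> = (\<Inter>i\<in>{0..I}. Y i -` A i \<inter> space N)" using YA by simp
    finally have E_eq: "E \<pi> = (\<Inter>i\<in>{0..I}. Y i -` A i \<inter> space N)" .
    \<comment> \<open>\<open>has_EPPF\<close> says nothing about size 0.\<close>
    have "1 \<le> ?m \<pi>"
    proof -
      obtain i where i: "i \<in> S" using S(2) by blast
      have "1 \<le> card (\<pi> i)" using i S(1) n by (intro card_partition_pos[OF \<pi>i]) auto
      also have "\<dots> \<le> ?m \<pi>" using finS i by (intro member_le_sum) auto
      finally show ?thesis .
    qed
    note cnt = count[OF this]
    have "prob (E \<pi>) = (\<Prod>i\<in>{0..I}. prob (Y i -` A i \<inter> space N))"
      unfolding E_eq by (rule indep_varsD_finite[OF indep]) (use A in auto)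
    also have "\<dots> = (\<Prod>i\<in>{0..I}. prob {\<omega> \<in> space N. R i (l i) \<omega> \<in> C i})"
      using YA by simp
    also have "\<dots> = prob {\<omega> \<in> space N. R 0 (l 0) \<omega> \<in> C 0} * (\<Prod>i\<in>{1..I}. prob {\<omega> \<in> space N. R i (l i) \<omega> \<in> C i})"
      unfolding split by (rule prod.insert) auto
    also have "prob {\<omega> \<in> space N. R 0 (l 0) \<omega> \<in> C 0} = block_count_prob q0 (?m \<pi>) k"
      using cnt by (simp add: C_def l_def)
    also have "(\<Prod>i\<in>{1..I}. prob {\<omega> \<in> space N. R i (l i) \<omega> \<in> C i}) = (\<Prod>i\<in>{1..I}. at_partition q (\<pi> i))"
      using eppf \<pi>i by (intro prod.cong) (auto simp: C_def l_def)
    finally have "prob (E \<pi>) = (\<Prod>i\<in>{1..I}. at_partition q (\<pi> i)) * block_count_prob q0 (?m \<pi>) k"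
      by (simp add: mult.commute)
    moreover have "E \<pi> \<in> events"
      unfolding E_eq using YA ev by (intro sets.finite_INT) auto
    ultimately show ?thesis by blast
  qed
  have "{\<omega> \<in> space N. card (R 0 (\<Sum>i\<in>S. card (R i (n i) \<omega>)) \<omega>) = k} = (\<Union>\<pi>\<in>?\<Theta>. E \<pi>)"
  proof (intro set_eqI iffI)
    fix \<omega> assume \<omega>: "\<omega> \<in> {\<omega> \<in> space N. card (R 0 (\<Sum>i\<in>S. card (R i (n i) \<omega>)) \<omega>) = k}"
    let ?\<pi> = "\<lambda>i\<in>{1..I}. R i (n i) \<omega>"
    have "?\<pi> \<in> ?\<Theta>" using \<omega> latent_in_partitions by auto
    moreover have "?m ?\<pi> = (\<Sum>i\<in>S. card (R i (n i) \<omega>))" using S(1) by (intro sum.cong) auto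
    then have "\<omega> \<in> E ?\<pi>" using \<omega> by (simp add: E_def)
    ultimately show "\<omega> \<in> (\<Union>\<pi>\<in>?\<Theta>. E \<pi>)" by blast
  next
    fix \<omega> assume "\<omega> \<in> (\<Union>\<pi>\<in>?\<Theta>. E \<pi>)"
    then obtain \<pi> where "\<omega> \<in> E \<pi>" by blast
    moreover from this have "?m \<pi> = (\<Sum>i\<in>S. card (R i (n i) \<omega>))"
      using S(1) by (intro sum.cong) (auto simp: E_def)
    ultimately show "\<omega> \<in> {\<omega> \<in> space N. card (R 0 (\<Sum>i\<in>S. card (R i (n i) \<omega>)) \<omega>) = k}"
      by (simp add: E_def)
  qed
  also have "prob (\<Union>\<pi>\<in>?\<Theta>. E \<pi>) = (\<Sum>\<pi>\<in>?\<Theta>. prob (E \<pi>))"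
  proof (rule finite_measure_finite_Union)
    show "finite ?\<Theta>" by (intro finite_PiE finite_partitions) simp
    show "disjoint_family_on E ?\<Theta>"
      unfolding disjoint_family_on_def
    proof (intro ballI impI)
      fix \<pi> \<pi>' assume *: "\<pi> \<in> ?\<Theta>" "\<pi>' \<in> ?\<Theta>" "\<pi> \<noteq> \<pi>'"
      then obtain i where "i \<in> {1..I}" "\<pi> i \<noteq> \<pi>' i" using PiE_ext[of \<pi> _ _ \<pi>'] by blast
      then show "E \<pi> \<inter> E \<pi>' = {}" by (auto simp: E_def)
    qed
  qed (use E_prob in blast)
  also have "\<dots> = (\<Sum>\<pi>\<in>?\<Theta>. (\<Prod>i\<in>{1..I}. at_partition q (\<pi> i)) * block_count_prob q0 (?m \<pi>) k)"
    using E_prob by (intro sum.cong) auto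
  finally show ?thesis .
qed

end

text \<open>Both counts are now expressed through the same sum over row partitions, so the number of
  distinct values has as its law the mixture of the \<open>distinct_law a k\<close> over the law of
  the latent cluster number. The first two claims are read off this mixture; the inequality is
  Bernoulli's.\<close>

lemma distinct_count_law:
  fixes M :: "'a measure" and N :: "'b measure"
    and \<xi> :: "nat \<Rightarrow> nat \<Rightarrow> 'a \<Rightarrow> 'x::polish_space" and n :: "nat \<Rightarrow> nat"
  defines "D \<equiv> \<lambda>S R \<omega>. card (R 0 (\<Sum>i\<in>S. card (R i (n i) \<omega> :: nat set set)) \<omega> :: nat set set)"
    and "D' \<equiv> \<lambda>S \<omega>. card ((\<lambda>(i, j). \<xi> i j \<omega>) ` (SIGMA i:S. {1..n i}))"
  assumes \<xi>: "HSSM M I \<xi> q q0 H0" and R: "latent_partitions N I R q q0"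
    and n: "\<And>i. i \<in> {1..I} \<Longrightarrow> 1 \<le> n i" and S: "S \<subseteq> {1..I}" "S \<noteq> {}"
    and null: "\<And>x. x \<noteq> x0 \<Longrightarrow> emeasure H0 {x} = 0" and atom: "measure H0 {x0} = a"
    and a: "0 \<le> a" "a \<le> 1"
  shows "d \<in> {1..\<Sum>i\<in>S. n i} \<Longrightarrow> measure M {\<omega> \<in> space M. D' S \<omega> = d} =
        (1 - a) ^ d * measure N {\<omega> \<in> space N. D S R \<omega> = d} +
        (\<Sum>k=d..(\<Sum>i\<in>S. n i). real (k choose (d - 1)) * a ^ (k + 1 - d) * (1 - a) ^ (d - 1) *
           measure N {\<omega> \<in> space N. D S R \<omega> = k})"
    and "(\<integral>\<omega>. real (D' S \<omega>) \<partial>M) =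
        1 - (\<integral>\<omega>. (1 - a) ^ D S R \<omega> \<partial>N) + (1 - a) * (\<integral>\<omega>. real (D S R \<omega>) \<partial>N)"
    and "1 - (\<integral>\<omega>. (1 - a) ^ D S R \<omega> \<partial>N) + (1 - a) * (\<integral>\<omega>. real (D S R \<omega>) \<partial>N)
        \<le> (\<integral>\<omega>. real (D S R \<omega>) \<partial>N)"
proof -
  interpret M: prob_space M using \<xi> by (simp add: HSSM_def)
  interpret N: prob_space N using R by (simp add: latent_partitions_def)
  let ?K = "\<Sum>i\<in>S. n i" and ?L = "SIGMA i:S. {1..n i}"
  let ?p = "\<lambda>k. measure N {\<omega> \<in> space N. D S R \<omega> = k}"
  have law: "measure M {\<omega> \<in> space M. D' S \<omega> = d} = (\<Sum>k=1..?K. distinct_law a k d * ?p k)"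
    if d: "1 \<le> d" for d
  proof -
    have "measure M {\<omega> \<in> space M. D' S \<omega> = d} =
      (\<Sum>\<pi>\<in>(\<Pi>\<^sub>E i\<in>{1..I}. partitions (n i)). (\<Prod>i\<in>{1..I}. at_partition q (\<pi> i)) *
        (\<Sum>k=1..?K. distinct_law a k d * block_count_prob q0 (\<Sum>i\<in>S. card (\<pi> i)) k))"
      unfolding D'_def by (rule HSSM_distinct_law[OF \<xi> n S null atom a d])
    \<comment> \<open>Exchanging the sums over row partitions and over \<open>k\<close> isolates the
      law of the latent cluster number.\<close>
    also have "\<dots> = (\<Sum>k=1..?K. distinct_law a k d *
       (\<Sum>\<pi>\<in>(\<Pi>\<^sub>E i\<in>{1..I}. partitions (n i)). (\<Prod>i\<in>{1..I}. at_partition q (\<pi> i)) *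
          block_count_prob q0 (\<Sum>i\<in>S. card (\<pi> i)) k))"
      by (simp only: sum_distrib_left mult.left_commute) (rule sum.swap)
    also have "\<dots> = (\<Sum>k=1..?K. distinct_law a k d * ?p k)"
      unfolding D_def by (simp only: prob_latent_count[OF R n S])
    finally show ?thesis .
  qed
  show "measure M {\<omega> \<in> space M. D' S \<omega> = d} =
        (1 - a) ^ d * ?p d + (\<Sum>k=d..?K. real (k choose (d - 1)) * a ^ (k + 1 - d) * (1 - a) ^ (d - 1) * ?p k)"
    if d: "d \<in> {1..?K}" for d
  proof -
    let ?t = "\<lambda>k. real (k choose (d - 1)) * a ^ (k + 1 - d) * (1 - a) ^ (d - 1) * ?p k"
    have "measure M {\<omega> \<in> space M. D' S \<omega> = d} =
        (\<Sum>k=1..?K. (if k = d then (1 - a) ^ d * ?p k else 0) + (if d \<le> k then ?t k else 0))"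
      using d by (subst law) (auto intro!: sum.cong simp: distinct_law_def distrib_right)
    also have "\<dots> = (1 - a) ^ d * ?p d + (\<Sum>k=1..?K. if d \<le> k then ?t k else 0)"
      using d by (simp add: sum.distrib)
    also have "(\<Sum>k=1..?K. if d \<le> k then ?t k else 0) = (\<Sum>k=d..?K. ?t k)"
      using d by (intro sum.mono_neutral_cong_right) auto
    finally show ?thesis .
  qed
  have finS: "finite S" using S by (auto intro: finite_subset)
  have D'_range: "D' S \<omega> \<in> {1..?K}" for \<omega>
  proof -
    obtain i where i: "i \<in> S" using S(2) by blast
    then have "(i, 1) \<in> ?L" using n[of i] S(1) by auto
    then have "finite ?L" "?L \<noteq> {}" using finS by blast+
    moreover have "card ?L = ?K" using finS by simp
    ultimately show ?thesis
      using card_image_le[of ?L "\<lambda>(i, j). \<xi> i j \<omega>"] by (simp add: D'_def Suc_le_eq card_gt_0_iff)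
  qed
  have D'_meas: "D' S \<in> measurable M (count_space UNIV)"
  proof -
    have "(\<lambda>\<omega>. card ((\<lambda>l. case l of (i, j) \<Rightarrow> \<xi> i j \<omega>) ` ?L)) \<in> measurable M (count_space UNIV)"
      by (rule measurable_card_image) (use finS S(1) \<xi> in \<open>auto simp: HSSM_def\<close>)
    then show ?thesis by (simp add: D'_def)
  qed
  have D_int: "(\<integral>\<omega>. h (D S R \<omega>) \<partial>N) = (\<Sum>k=1..?K. h k * ?p k)" for h :: "nat \<Rightarrow> real"
    unfolding D_def
    by (rule N.expectation_nat_valued[OF measurable_latent_count[OF R n S] latent_count_range[OF R n S]])
  \<comment> \<open>The case \<open>h = 1\<close> supplies the constant 1 in the formula for the
    mean.\<close>
  have total: "(\<Sum>k=1..?K. ?p k) = 1" using D_int[of "\<lambda>_. 1"] by (simp add: N.prob_space)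
  have "(\<integral>\<omega>. real (D' S \<omega>) \<partial>M) = (\<Sum>d=1..?K. real d * measure M {\<omega> \<in> space M. D' S \<omega> = d})"
    by (rule M.expectation_nat_valued[OF D'_meas D'_range])
  also have "\<dots> = (\<Sum>d=1..?K. \<Sum>k=1..?K. real d * distinct_law a k d * ?p k)"
    by (intro sum.cong refl) (subst law, auto simp: sum_distrib_left mult.assoc)
  also have "\<dots> = (\<Sum>k=1..?K. (\<Sum>d=1..?K. real d * distinct_law a k d) * ?p k)"
    by (subst sum.swap) (simp add: sum_distrib_right)
  also have "\<dots> = (\<Sum>k=1..?K. (1 - (1 - a) ^ k + (1 - a) * real k) * ?p k)"
  proof (intro sum.cong refl arg_cong2[where f="(*)"])
    fix k assume k: "k \<in> {1..?K}"
    \<comment> \<open>\<open>k\<close> draws have at most \<open>k\<close> values, so the terms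
      beyond \<open>k\<close> are zero and the mean is the one already computed.\<close>
    have "(\<Sum>d=1..?K. real d * distinct_law a k d) = (\<Sum>d=1..k. real d * distinct_law a k d)"
      using k by (intro sum.mono_neutral_right) (auto simp: distinct_law_def)
    then show "(\<Sum>d=1..?K. real d * distinct_law a k d) = 1 - (1 - a) ^ k + (1 - a) * real k"
      by (simp only: expectation_distinct_law)
  qed
  also have "\<dots> = (\<Sum>k=1..?K. ?p k) - (\<Sum>k=1..?K. (1 - a) ^ k * ?p k) + (1 - a) * (\<Sum>k=1..?K. real k * ?p k)"
    by (simp only: distrib_right left_diff_distrib sum.distrib sum_subtractf sum_distrib_left mult_1_left mult.assoc)
  finally show mean: "(\<integral>\<omega>. real (D' S \<omega>) \<partial>M) =
        1 - (\<integral>\<omega>. (1 - a) ^ D S R \<omega> \<partial>N) + (1 - a) * (\<integral>\<omega>. real (D S R \<omega>) \<partial>N)"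
    by (simp only: total D_int)
  \<comment> \<open>Subtracting \<open>1 - a\<close> times the mean of \<open>D S R\<close> from the
    asserted bound leaves this. It is Bernoulli's inequality
    \<open>(1 - a) ^ k \<ge> 1 - a * k\<close> averaged over the latent law.\<close>
  have "1 - (\<integral>\<omega>. (1 - a) ^ D S R \<omega> \<partial>N) \<le> a * (\<integral>\<omega>. real (D S R \<omega>) \<partial>N)"
  proof -
    have "(\<Sum>k=1..?K. ?p k) - (\<Sum>k=1..?K. (1 - a) ^ k * ?p k) = (\<Sum>k=1..?K. (1 - (1 - a) ^ k) * ?p k)"
      by (simp add: left_diff_distrib sum_subtractf)
    also have "\<dots> \<le> (\<Sum>k=1..?K. a * real k * ?p k)"
    proof (intro sum_mono mult_right_mono measure_nonneg)
      fix k
      show "1 - (1 - a) ^ k \<le> a * real k"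
        using Bernoulli_inequality[of "- a" k] a by (simp add: mult.commute)
    qed
    also have "\<dots> = a * (\<Sum>k=1..?K. real k * ?p k)" by (simp add: sum_distrib_left mult.assoc)
    finally show ?thesis by (simp only: total D_int)
  qed
  then show "1 - (\<integral>\<omega>. (1 - a) ^ D S R \<omega> \<partial>N) + (1 - a) * (\<integral>\<omega>. real (D S R \<omega>) \<partial>N)
        \<le> (\<integral>\<omega>. real (D S R \<omega>) \<partial>N)"
    by (simp add: left_diff_distrib)
qed

theorem proposition8:
  fixes M :: "'a measure" and N :: "'b measure"
    and \<xi> :: "nat \<Rightarrow> nat \<Rightarrow> 'a \<Rightarrow> 'x::polish_space"
    and R :: "nat \<Rightarrow> nat \<Rightarrow> 'b \<Rightarrow> nat set set"
    and q q0 :: symmetric_fun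
    and H0 H :: "'x measure" and x0 :: 'x and a :: real
    and I :: nat and n :: "nat \<Rightarrow> nat"
  assumes a: "0 < a" "a < 1"
    and H: "prob_space H" "sets H = sets borel" "diffuse H"
    and H0: "sets H0 = sets borel"
      "\<And>A. A \<in> sets borel \<Longrightarrow>
         emeasure H0 A = ennreal a * emeasure (return borel x0) A + ennreal (1 - a) * emeasure H A"
    and I: "1 \<le> I"
    and n: "\<And>i. i \<in> {1..I} \<Longrightarrow> 1 \<le> n i"
    and \<xi>: "HSSM M I \<xi> q q0 H0"
    and R: "latent_partitions N I R q q0"
  shows
    "(\<forall>i\<in>{1..I}. \<forall>d\<in>{1..n i}.
        measure M {\<omega> \<in> space M. distinct_row \<xi> n i \<omega> = d} =
        (1 - a) ^ d * measure N {\<omega> \<in> space N. D_row R n i \<omega> = d} +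
        (\<Sum>k=d..n i. real (k choose (d - 1)) * a ^ (k + 1 - d) * (1 - a) ^ (d - 1) *
           measure N {\<omega> \<in> space N. D_row R n i \<omega> = k})) \<and>
     (\<forall>d\<in>{1..(\<Sum>i=1..I. n i)}.
        measure M {\<omega> \<in> space M. distinct_total \<xi> I n \<omega> = d} =
        (1 - a) ^ d * measure N {\<omega> \<in> space N. D_total R I n \<omega> = d} +
        (\<Sum>k=d..(\<Sum>i=1..I. n i). real (k choose (d - 1)) * a ^ (k + 1 - d) * (1 - a) ^ (d - 1) *
           measure N {\<omega> \<in> space N. D_total R I n \<omega> = k})) \<and>
     (\<forall>i\<in>{1..I}.
        (\<integral>\<omega>. real (distinct_row \<xi> n i \<omega>) \<partial>M) =
          1 - (\<integral>\<omega>. (1 - a) ^ D_row R n i \<omega> \<partial>N) + (1 - a) * (\<integral>\<omega>. real (D_row R n i \<omega>) \<partial>N) \<and>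
        1 - (\<integral>\<omega>. (1 - a) ^ D_row R n i \<omega> \<partial>N) + (1 - a) * (\<integral>\<omega>. real (D_row R n i \<omega>) \<partial>N)
          \<le> (\<integral>\<omega>. real (D_row R n i \<omega>) \<partial>N)) \<and>
     (\<integral>\<omega>. real (distinct_total \<xi> I n \<omega>) \<partial>M) =
       1 - (\<integral>\<omega>. (1 - a) ^ D_total R I n \<omega> \<partial>N) + (1 - a) * (\<integral>\<omega>. real (D_total R I n \<omega>) \<partial>N) \<and>
     1 - (\<integral>\<omega>. (1 - a) ^ D_total R I n \<omega> \<partial>N) + (1 - a) * (\<integral>\<omega>. real (D_total R I n \<omega>) \<partial>N)
       \<le> (\<integral>\<omega>. real (D_total R I n \<omega>) \<partial>N)"
proof -
  have space_H: "space H = UNIV" using sets_eq_imp_space_eq[OF H(2)] by simp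
  \<comment> \<open>Diffuseness of \<open>H\<close> leaves \<open>x0\<close> as the only atom of
    \<open>H0\<close>, with mass exactly \<open>a\<close>.\<close>
  have null: "emeasure H0 {x} = 0" if "x \<noteq> x0" for x
    using H(3) that space_H by (subst H0(2)) (auto simp: diffuse_def)
  have "emeasure H0 {x0} = ennreal a"
    using H(3) space_H by (subst H0(2)) (auto simp: diffuse_def)
  then have atom: "measure H0 {x0} = a" using a by (simp add: measure_def)
  have a': "0 \<le> a" "a \<le> 1" using a by auto
  note law = distinct_count_law[where n=n and ?x0.0=x0 and a=a, OF \<xi> R n _ _ null atom a']
  have row: "distinct_row \<xi> n i \<omega> = card ((\<lambda>(i, j). \<xi> i j \<omega>) ` (SIGMA i:{i}. {1..n i}))" for i \<omega>
    unfolding distinct_row_def by (rule arg_cong[where f=card]) auto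
  have total: "distinct_total \<xi> I n \<omega> = card ((\<lambda>(i, j). \<xi> i j \<omega>) ` (SIGMA i:{1..I}. {1..n i}))" for \<omega>
    unfolding distinct_total_def by (rule arg_cong[where f=card]) force
  have D_row: "D_row R n i \<omega> = card (R 0 (\<Sum>i\<in>{i}. card (R i (n i) \<omega>)) \<omega>)" for i \<omega>
    by (simp add: D_row_def K_row_def)
  have D_total: "D_total R I n \<omega> = card (R 0 (\<Sum>i\<in>{1..I}. card (R i (n i) \<omega>)) \<omega>)" for \<omega>
    by (simp add: D_total_def K_total_def)
  have n1: "(\<Sum>i\<in>{i}. n i) = n i" for i by simp
  note law_row = law[where S="{i}" for i, folded row D_row, unfolded n1]
  note law_total = law[where S="{1..I}", folded total D_total]
  show ?thesis
    using I by (intro conjI ballI) (rule law_row law_total; (assumption | simp))+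
qed

end
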